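(* For every $k,d\in\mathbb{N}$ the following two statements are true. (i) $\alpha\text{-}\mathsf{td}(P_k)=\lceil\log(\frac{k}{3}+1)\rceil\ge\log(k/3)$. (ii) For every $\{P_k,K_{1,d}\}$-free graph $G$ it holds that $\alpha\text{-}\mathsf{td}(G)\le\max\{1,(d-1)(k-2)\}$.
   Context: All graphs are finite, simple, and undirected; all logarithms are base $2$; $\mathbb{N}$ is the set of positive integers. $P_k$ is the path on $k$ vertices and $K_{1,d}$ is the star with $d$ leaves. A graph is $\{P_k,K_{1,d}\}$-free if it contains neither $P_k$ nor $K_{1,d}$ as an induced subgraph. A rooted forest is a forest with one chosen vertex (root) in each connected component. An elimination forest for a graph $G$ is a rooted forest $F$ with $V(F)=V(G)$ such that for every edge $uv\in E(G)$ there is a root-to-leaf path $P$ in $F$ with $u,v\in V(P)$. Here a root-to-leaf path is a path in $F$ from a root to a vertex of the same component having no descendants (a single vertex if the component has one vertex). The $\alpha$-depth of $F$ is the maximum of $\alpha(G[V(P)])$ over all root-to-leaf paths $P$ in $F$, where $\alpha$ denotes the independence number. The $\alpha$-treedepth $\alpha\text{-}\mathsf{td}(G)$ is the minimum $\alpha$-depth over all elimination forests for $G$. *)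

theory Defs
  imports Complex_Main "Graph_Theory.Graph_Theory"
begin

text \<open>
  A finite simple undirected graph is a \<^locale>\<open>pair_graph\<close>: a finite vertex set with a
  symmetric irreflexive set of arcs (both orientations of each edge). The graph without vertices
  is included.
\<close>

definition path_graph :: "nat \<Rightarrow> nat pair_pre_digraph" where
  "path_graph k = \<lparr> pverts = {..<k},
     parcs = {(i, j). i < k \<and> j < k \<and> (j = Suc i \<or> i = Suc j)} \<rparr>"

definition path_star_free :: "nat \<Rightarrow> nat \<Rightarrow> 'a pair_pre_digraph \<Rightarrow> bool" where
  "path_star_free k d G \<longleftrightarrow>
     \<not> (\<exists>H. induced_subgraph H (with_proj G) \<and> digraph_iso (with_proj (path_graph k)) H) \<and>
     \<not> (\<exists>H. induced_subgraph H (with_proj G) \<and> complete_bipartite_digraph 1 d H)"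

definition independence_number :: "('a, 'b) pre_digraph \<Rightarrow> nat" where
  "independence_number G =
     Max {card S | S. S \<subseteq> verts G \<and> (\<forall>u\<in>S. \<forall>v\<in>S. (u, v) \<notin> arcs_ends G)}"

text \<open>
  The library's \<^const>\<open>forest\<close> is meant for digraphs: in a symmetric digraph it counts
  \<open>u, v, u\<close> as a cycle, so it forbids all edges. A cycle of an undirected graph has length
  at least three.
\<close>

definition undirected_forest :: "'a pair_pre_digraph \<Rightarrow> bool" where
  "undirected_forest F \<longleftrightarrow>
     pair_graph F \<and> \<not> (\<exists>p. pre_digraph.cycle (with_proj F) p \<and> 3 \<le> length p)"

text \<open>
  \<open>R\<close> is the set of roots. As arcs are symmetric, the strongly connected components
  are the connected components.
\<close>

definition rooted_forest :: "'a pair_pre_digraph \<Rightarrow> 'a set \<Rightarrow> bool" where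
  "rooted_forest F R \<longleftrightarrow> undirected_forest F \<and> R \<subseteq> pverts F \<and>
     (\<forall>C \<in> pre_digraph.sccs_verts (with_proj F). \<exists>!r. r \<in> R \<inter> C)"

text \<open>\<open>w\<close> is a descendant of \<open>v\<close>: the path from the root to \<open>w\<close> passes through \<open>v \<noteq> w\<close>.\<close>

definition descendant :: "'a pair_pre_digraph \<Rightarrow> 'a set \<Rightarrow> 'a \<Rightarrow> 'a \<Rightarrow> bool" where
  "descendant F R v w \<longleftrightarrow> w \<noteq> v \<and>
     (\<exists>p. vpath p (with_proj F) \<and> hd p \<in> R \<and> last p = w \<and> v \<in> set p)"

definition root_to_leaf_path :: "'a pair_pre_digraph \<Rightarrow> 'a set \<Rightarrow> 'a list \<Rightarrow> bool" where
  "root_to_leaf_path F R p \<longleftrightarrow>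
     vpath p (with_proj F) \<and> hd p \<in> R \<and> \<not> (\<exists>w. descendant F R (last p) w)"

definition elimination_forest :: "'a pair_pre_digraph \<Rightarrow> 'a pair_pre_digraph \<Rightarrow> 'a set \<Rightarrow> bool" where
  "elimination_forest G F R \<longleftrightarrow> rooted_forest F R \<and> pverts F = pverts G \<and>
     (\<forall>(u, v) \<in> parcs G. \<exists>p. root_to_leaf_path F R p \<and> u \<in> set p \<and> v \<in> set p)"

text \<open>
  The inserted \<open>0\<close> only matters for the graph without vertices, which has no root-to-leaf path.
\<close>

definition alpha_depth :: "'a pair_pre_digraph \<Rightarrow> 'a pair_pre_digraph \<Rightarrow> 'a set \<Rightarrow> nat" where
  "alpha_depth G F R = Max (insert 0
     {independence_number (with_proj G \<restriction> set p) | p. root_to_leaf_path F R p})"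

definition alpha_treedepth :: "'a pair_pre_digraph \<Rightarrow> nat" where
  "alpha_treedepth G = (LEAST n. \<exists>F R. elimination_forest G F R \<and> alpha_depth G F R = n)"

end

theory Submission
  imports Defs "HOL-Library.Sublist"
begin

text \<open>
  An elimination forest only matters through its ancestor order: the ends of every edge are
  comparable, and the \<open>\<alpha>\<close>-depth is the largest size of an independent chain. Such orders are
  represented by labelling the vertices with lists ordered by the prefix relation. Lemma
  \<open>alpha_treedepth_le_iff\<close> shows that labellings and elimination forests give the same depths: the
  cover relation of a labelling is a rooted forest, and conversely the paths from the roots of
  an elimination forest, which are unique because it has no cycle, are labels. Labellings can be
  restricted to subsets and glued together (\<open>eliminable_top\<close>, \<open>eliminable_components\<close>), and all
  the graph-theoretic arguments are made for them.

  Paths. Let \<open>h n\<close> be the largest number of vertices of a path of \<open>\<alpha>\<close>-treedepth at most \<open>n\<close>. Taking the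
  middle vertex as root with its two neighbours as children shows \<open>h (n + 1) \<ge> 2 h n + 3\<close>, since a
  vertex and its neighbour together contribute only one to an independent set
  (\<open>eliminable_interval\<close>). Conversely, the root of the whole path can be added to every independent
  chain that avoids it and its neighbours, so each of the two intervals that remain without these
  three vertices has \<open>\<alpha>\<close>-treedepth at most \<open>n\<close>, which gives \<open>h (n + 1) \<le> 2 h n + 3\<close>
  (\<open>labelled_interval_length\<close>). Hence \<open>h n = 3 (2\<^sup>n - 1)\<close>, and \<open>k \<le> h n\<close> means
  \<open>k / 3 + 1 \<le> 2\<^sup>n\<close>.

  Graphs without an induced path on \<open>k\<close> vertices and an induced star with \<open>d\<close> leaves. This is Gyarfas'
  path argument. Eliminate the closed neighbourhood of a vertex, continue in each remaining
  component with a neighbour of the vertex that is adjacent to the component, and so on. The chosen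
  vertices form an induced path, and it could be prolonged by one further neighbour and a vertex of a
  remaining component. So nothing remains after \<open>k - 2\<close> rounds. A closed neighbourhood contains no
  independent set of size \<open>d\<close>, so every round contributes at most \<open>d - 1\<close>
  (\<open>eliminable_of_no_induced_path\<close>).
\<close>

section \<open>Elimination labellings\<close>

definition independent :: "'a rel \<Rightarrow> 'a set \<Rightarrow> bool" where
  "independent E S \<longleftrightarrow> (\<forall>u\<in>S. \<forall>v\<in>S. (u, v) \<notin> E)"

text \<open>
  Elimination schemes are glued together from pieces in which different bounds hold, so the bound is
  kept as a predicate on sets rather than as the number \<open>\<alpha>\<close>.
\<close>

definition alpha_at_most :: "'a rel \<Rightarrow> nat \<Rightarrow> 'a set \<Rightarrow> bool" where
  "alpha_at_most E n S \<longleftrightarrow> (\<forall>T\<subseteq>S. independent E T \<longrightarrow> card T \<le> n)"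

abbreviation comparable :: "'a list \<Rightarrow> 'a list \<Rightarrow> bool" where
  "comparable xs ys \<equiv> prefix xs ys \<or> prefix ys xs"

definition label_chain :: "('a \<Rightarrow> 'a list) \<Rightarrow> 'a set \<Rightarrow> bool" where
  "label_chain f S \<longleftrightarrow> (\<forall>u\<in>S. \<forall>v\<in>S. comparable (f u) (f v))"

text \<open>
  Rooted forests on \<open>V\<close> are encoded by labelling the vertices with lists: \<open>u\<close> is an ancestor of \<open>v\<close>
  when the label of \<open>u\<close> is a prefix of that of \<open>v\<close>. The prefixes of a list form a chain, so every
  injective labelling describes a forest order and there are no order axioms to maintain. The
  chains of the order are the subsets of the root-to-leaf paths. The condition on chains is an
  arbitrary predicate \<open>Q\<close> because, below vertices that have already been placed on top, what counts
  is the independence number of the chain together with these vertices.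
\<close>

definition elimination_labelling ::
    "'a rel \<Rightarrow> 'a set \<Rightarrow> ('a set \<Rightarrow> bool) \<Rightarrow> ('a \<Rightarrow> 'a list) \<Rightarrow> bool" where
  "elimination_labelling E V Q f \<longleftrightarrow> inj_on f V \<and>
     (\<forall>u\<in>V. \<forall>v\<in>V. (u, v) \<in> E \<longrightarrow> comparable (f u) (f v)) \<and>
     (\<forall>S\<subseteq>V. label_chain f S \<longrightarrow> Q S)"

definition eliminable :: "'a rel \<Rightarrow> 'a set \<Rightarrow> ('a set \<Rightarrow> bool) \<Rightarrow> bool" where
  "eliminable E V Q \<longleftrightarrow> (\<exists>f. elimination_labelling E V Q f)"

lemma eliminableI:
  assumes "inj_on f V"
    and "\<And>u v. u \<in> V \<Longrightarrow> v \<in> V \<Longrightarrow> (u, v) \<in> E \<Longrightarrow> comparable (f u) (f v)"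
    and "\<And>S. S \<subseteq> V \<Longrightarrow> label_chain f S \<Longrightarrow> Q S"
  shows "eliminable E V Q"
  using assms unfolding eliminable_def elimination_labelling_def by (intro exI[of _ f]) simp

lemma elimination_labellingD:
  assumes "elimination_labelling E V Q f"
  shows "inj_on f V"
    and "\<And>u v. u \<in> V \<Longrightarrow> v \<in> V \<Longrightarrow> (u, v) \<in> E \<Longrightarrow> comparable (f u) (f v)"
    and "\<And>S. S \<subseteq> V \<Longrightarrow> label_chain f S \<Longrightarrow> Q S"
  using assms unfolding elimination_labelling_def by simp_all

lemma eliminable_weaken:
  assumes "eliminable E V Q" and "\<And>S. S \<subseteq> V \<Longrightarrow> Q S \<Longrightarrow> Q' S"
  shows "eliminable E V Q'"
proof -
  obtain f where "elimination_labelling E V Q f" using assms(1) by (auto simp: eliminable_def)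
  then have "elimination_labelling E V Q' f"
    using assms(2) by (simp add: elimination_labelling_def)
  then show ?thesis by (auto simp: eliminable_def)
qed

lemma alpha_at_most_empty: "alpha_at_most E n {}"
  by (simp add: alpha_at_most_def)

lemma eliminable_empty: "Q {} \<Longrightarrow> eliminable E {} Q"
  by (simp add: eliminable_def elimination_labelling_def)

lemma independent_subset: "independent E S \<Longrightarrow> T \<subseteq> S \<Longrightarrow> independent E T"
  by (auto simp: independent_def)

lemma alpha_at_most_mono: "alpha_at_most E m S \<Longrightarrow> m \<le> n \<Longrightarrow> T \<subseteq> S \<Longrightarrow> alpha_at_most E n T"
  unfolding alpha_at_most_def by (meson order_trans)

lemma alpha_at_most_Un:
  assumes "alpha_at_most E m S" "alpha_at_most E n T"
  shows "alpha_at_most E (m + n) (S \<union> T)"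
  unfolding alpha_at_most_def
proof (intro allI impI)
  fix I assume I: "I \<subseteq> S \<union> T" "independent E I"
  have "card (I \<inter> S) \<le> m" "card (I - S) \<le> n"
    using assms I independent_subset[OF I(2)] unfolding alpha_at_most_def
    by (auto intro!: assms(1)[unfolded alpha_at_most_def, rule_format]
        assms(2)[unfolded alpha_at_most_def, rule_format])
  moreover have "card I \<le> card (I \<inter> S) + card (I - S)"
    by (metis Int_Diff_Un card_Un_le)
  ultimately show "card I \<le> m + n" by linarith
qed

lemma alpha_at_most_card: "finite S \<Longrightarrow> card S \<le> n \<Longrightarrow> alpha_at_most E n S"
  unfolding alpha_at_most_def by (meson card_mono order_trans)

text \<open>
  Placing the vertices of \<open>X\<close> in a row above a scheme for the rest: they get the proper prefixes of
  one fixed list \<open>xs\<close>, and \<open>xs\<close> is put in front of all other labels. A chain then splits into a part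
  inside \<open>X\<close>, which is arbitrary, and a chain of the rest.
\<close>

lemma eliminable_top:
  assumes X: "finite X" "X \<subseteq> V"
    and rest: "eliminable E (V - X) (\<lambda>S. \<forall>T\<subseteq>X. Q (T \<union> S))"
  shows "eliminable E V Q"
proof -
  obtain g where "elimination_labelling E (V - X) (\<lambda>S. \<forall>T\<subseteq>X. Q (T \<union> S)) g"
    using rest by (auto simp: eliminable_def)
  note inj = elimination_labellingD(1)[OF this] and edge = elimination_labellingD(2)[OF this]
    and chain = elimination_labellingD(3)[OF this]
  obtain xs where xs: "set xs = X" "distinct xs" using X(1) finite_distinct_list by blast
  define pos where "pos v = (THE i. i < length xs \<and> xs ! i = v)" for v
  have pos: "pos v < length xs \<and> xs ! pos v = v" if "v \<in> X" for v
  proof -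
    have "\<exists>!i. i < length xs \<and> xs ! i = v"
      using that xs by (metis distinct_Ex1)
    then show ?thesis unfolding pos_def by (rule theI')
  qed
  define f where "f v = (if v \<in> X then take (pos v) xs else xs @ g v)" for v
  have fX: "prefix (f u) (f v)" if "u \<in> X" "v \<notin> X" for u v
    using that by (simp add: f_def take_is_prefix)
  have fXX: "comparable (f u) (f v)" if "u \<in> X" "v \<in> X" for u v
    using that prefix_same_cases[OF take_is_prefix take_is_prefix, of "pos u" xs "pos v"]
    by (simp add: f_def)
  have fV: "comparable (f u) (f v) \<longleftrightarrow> comparable (g u) (g v)" if "u \<notin> X" "v \<notin> X" for u v
    using that by (simp add: f_def)
  have injf: "inj_on f V"
  proof (rule inj_onI)
    fix u v assume uv: "u \<in> V" "v \<in> V" "f u = f v"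
    have len: "length (f w) < length xs \<longleftrightarrow> w \<in> X" for w
      using pos[of w] by (auto simp: f_def)
    show "u = v"
    proof (cases "u \<in> X")
      case True
      then have "v \<in> X" using len uv(3) by metis
      have "length (f u) = pos u" "length (f v) = pos v"
        using pos[OF True] pos[OF \<open>v \<in> X\<close>] True \<open>v \<in> X\<close> by (auto simp: f_def)
      then show ?thesis using pos[OF True] pos[OF \<open>v \<in> X\<close>] uv(3) by metis
    next
      case False
      then have "v \<notin> X" using len uv(3) by metis
      then show ?thesis using False uv inj by (auto simp: f_def inj_on_def)
    qed
  qed
  have "Q S" if S: "S \<subseteq> V" "label_chain f S" for S
  proof -
    have "label_chain g (S - X)"
      using S(2) fV unfolding label_chain_def by (metis DiffE)
    moreover have "S - X \<subseteq> V - X" using S(1) by blast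
    ultimately have "Q (S \<inter> X \<union> (S - X))" using chain[of "S - X"] by simp
    then show ?thesis by (simp add: Int_Diff_Un)
  qed
  moreover have "comparable (f u) (f v)" if "u \<in> V" "v \<in> V" "(u, v) \<in> E" for u v
    using that fX fXX fV edge by (cases "u \<in> X"; cases "v \<in> X") blast+
  ultimately show ?thesis using injf by (rule_tac eliminableI)
qed

text \<open>
  Two parts without edges between them get trees of their own: distinct first letters make the
  labels of one part incomparable with those of the other.
\<close>

lemma eliminable_Un:
  assumes A: "eliminable E A Q" and B: "eliminable E B Q" and disj: "A \<inter> B = {}"
    and none: "\<And>u v. u \<in> A \<Longrightarrow> v \<in> B \<Longrightarrow> (u, v) \<notin> E \<and> (v, u) \<notin> E"
  shows "eliminable E (A \<union> B) Q"
proof (cases "A = {} \<or> B = {}")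
  case True
  then show ?thesis using A B by auto
next
  case False
  then obtain a b where ab: "a \<in> A" "b \<in> B" "a \<noteq> b" using disj by blast
  obtain f where "elimination_labelling E A Q f" using A by (auto simp: eliminable_def)
  note f = elimination_labellingD[OF this]
  obtain g where "elimination_labelling E B Q g" using B by (auto simp: eliminable_def)
  note g = elimination_labellingD[OF this]
  define h where "h v = (if v \<in> A then a # f v else b # g v)" for v
  have hA: "h v = a # f v" if "v \<in> A" for v using that by (simp add: h_def)
  have hB: "h v = b # g v" if "v \<in> B" for v using that disj by (auto simp: h_def)
  have "inj_on h (A \<union> B)"
    using f(1) g(1) ab(3) hA hB unfolding inj_on_def by (metis Un_iff list.inject)
  moreover have "comparable (h u) (h v)" if uv: "u \<in> A \<union> B" "v \<in> A \<union> B" "(u, v) \<in> E" for u v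
  proof -
    consider "u \<in> A" "v \<in> A" | "u \<in> B" "v \<in> B" using uv none by blast
    then show ?thesis
      using f(2)[of u v] g(2)[of u v] uv(3) hA hB by cases simp_all
  qed
  moreover have "Q S" if S: "S \<subseteq> A \<union> B" "label_chain h S" for S
  proof -
    have "S \<subseteq> A \<or> S \<subseteq> B"
    proof (rule ccontr)
      assume "\<not> (S \<subseteq> A \<or> S \<subseteq> B)"
      then obtain u v where "u \<in> S" "u \<in> A" "v \<in> S" "v \<in> B" using S(1) by blast
      then have "comparable (a # f u) (b # g v)" using S(2) hA hB unfolding label_chain_def by metis
      then show False using ab(3) by simp
    qed
    then show ?thesis
    proof
      assume SA: "S \<subseteq> A"
      then have "label_chain f S" using S(2) hA unfolding label_chain_def
        by (metis Cons_prefix_Cons subsetD)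
      then show ?thesis using SA f(3) by simp
    next
      assume SB: "S \<subseteq> B"
      then have "label_chain g S" using S(2) hB unfolding label_chain_def
        by (metis Cons_prefix_Cons subsetD)
      then show ?thesis using SB g(3) by simp
    qed
  qed
  ultimately show ?thesis by (rule eliminableI)
qed

text \<open>
  Connectedness in the form of cuts: every proper nonempty part is left by an edge. This is the
  form in which connectedness is used below, and it needs no walks.
\<close>

definition connected_in :: "'a rel \<Rightarrow> 'a set \<Rightarrow> bool" where
  "connected_in E S \<longleftrightarrow> (\<forall>T\<subseteq>S. T \<noteq> {} \<longrightarrow> T \<noteq> S \<longrightarrow> (\<exists>x\<in>T. \<exists>y\<in>S - T. (x, y) \<in> E))"

text \<open>
  A set that is not connected splits along a cut without edges, so by induction only connected sets
  without edges to the rest, that is components, have to be dealt with.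
\<close>

lemma eliminable_components:
  assumes "finite U" "sym E" "Q {}"
    and comp: "\<And>D. D \<subseteq> U \<Longrightarrow> D \<noteq> {} \<Longrightarrow> connected_in E D \<Longrightarrow>
      (\<And>x y. x \<in> D \<Longrightarrow> y \<in> U - D \<Longrightarrow> (x, y) \<notin> E) \<Longrightarrow> eliminable E D Q"
  shows "eliminable E U Q"
  using assms(1) comp
proof (induction rule: finite_psubset_induct)
  case (psubset U)
  show ?case
  proof (cases "U = {} \<or> connected_in E U")
    case True
    then show ?thesis using eliminable_empty[of Q E] psubset.prems[of U] assms(3) by auto
  next
    case False
    then obtain T where T: "T \<subseteq> U" "T \<noteq> {}" "T \<noteq> U"
      and cut: "\<And>x y. x \<in> T \<Longrightarrow> y \<in> U - T \<Longrightarrow> (x, y) \<notin> E"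
      unfolding connected_in_def by blast
    have cut': "\<And>x y. x \<in> T \<Longrightarrow> y \<in> U - T \<Longrightarrow> (y, x) \<notin> E"
      using cut assms(2) by (meson symE)
    have "eliminable E T Q"
    proof (rule psubset.IH)
      show "T \<subset> U" using T by blast
      fix D assume D: "D \<subseteq> T" "D \<noteq> {}" "connected_in E D"
        "\<And>x y. x \<in> D \<Longrightarrow> y \<in> T - D \<Longrightarrow> (x, y) \<notin> E"
      show "eliminable E D Q"
        by (rule psubset.prems) (use D T cut in blast)+
    qed
    moreover have "eliminable E (U - T) Q"
    proof (rule psubset.IH)
      show "U - T \<subset> U" using T by blast
      fix D assume D: "D \<subseteq> U - T" "D \<noteq> {}" "connected_in E D"
        "\<And>x y. x \<in> D \<Longrightarrow> y \<in> U - T - D \<Longrightarrow> (x, y) \<notin> E"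
      show "eliminable E D Q"
        by (rule psubset.prems) (use D T cut' in blast)+
    qed
    ultimately have "eliminable E (T \<union> (U - T)) Q"
      using eliminable_Un[of E T Q "U - T"] cut cut' psubset.hyps by blast
    then show ?thesis using T(1) by (simp add: Un_absorb1)
  qed
qed

section \<open>Labellings of paths\<close>

abbreviation path_arcs :: "nat \<Rightarrow> nat rel" where
  "path_arcs k \<equiv> parcs (path_graph k)"

lemma path_arcs_iff: "(i, j) \<in> path_arcs k \<longleftrightarrow> i < k \<and> j < k \<and> (j = Suc i \<or> i = Suc j)"
  by (simp add: path_graph_def)

lemma alpha_at_most_edge:
  assumes "(x, y) \<in> E"
  shows "alpha_at_most E 1 {x, y}"
  unfolding alpha_at_most_def
proof (intro allI impI)
  fix T assume T: "T \<subseteq> {x, y}" "independent E T"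
  then have "T \<subseteq> {x} \<or> T \<subseteq> {y}" using assms by (auto simp: independent_def)
  then show "card T \<le> 1" using card_mono[of "{x}" T] card_mono[of "{y}" T] by auto
qed

text \<open>
  This is where the labelling gains over removing one vertex at a time: below \<open>m\<close> a neighbour \<open>x\<close> of
  \<open>m\<close> comes for free, as an independent set contains at most one of the two.
\<close>

lemma eliminable_edge_top:
  assumes "(m, x) \<in> E" "x \<notin> W" and W: "eliminable E W (alpha_at_most E n)"
  shows "eliminable E (insert x W) (\<lambda>S. \<forall>T\<subseteq>{m}. alpha_at_most E (Suc n) (T \<union> S))"
proof (rule eliminable_top[where X = "{x}"])
  have "insert x W - {x} = W" using assms(2) by simp
  moreover have "eliminable E W (\<lambda>S. \<forall>T\<subseteq>{x}. \<forall>T'\<subseteq>{m}. alpha_at_most E (Suc n) (T' \<union> (T \<union> S)))"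
  proof (rule eliminable_weaken[OF W], intro allI impI)
    fix S T T' assume S: "alpha_at_most E n S" and T: "T \<subseteq> {x}" "T' \<subseteq> {m}"
    have "alpha_at_most E (1 + n) ({m, x} \<union> S)"
      using alpha_at_most_Un[OF alpha_at_most_edge[OF assms(1)] S] .
    then show "alpha_at_most E (Suc n) (T' \<union> (T \<union> S))"
      by (rule alpha_at_most_mono) (use T in auto)
  qed
  ultimately show "eliminable E (insert x W - {x})
      (\<lambda>S. \<forall>T\<subseteq>{x}. \<forall>T'\<subseteq>{m}. alpha_at_most E (Suc n) (T' \<union> (T \<union> S)))" by simp
qed auto

text \<open>
  The largest number \<open>h n\<close> of vertices of a path that can be handled with depth \<open>n\<close> satisfies
  \<open>h (n + 1) = 2 h n + 3\<close>, that is \<open>h n = 3 (2\<^sup>n - 1)\<close>. For the lower bound on \<open>h (n + 1)\<close> take the middle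
  vertex \<open>m\<close> as root and give it the two children \<open>m - 1\<close> and \<open>m + 1\<close>: this increases the depth by
  one and leaves an interval of \<open>h n\<close> vertices on either side.
\<close>

lemma eliminable_interval:
  assumes "b \<le> k" "b + 3 \<le> a + 3 * 2 ^ n"
  shows "eliminable (path_arcs k) {a..<b} (alpha_at_most (path_arcs k) n)"
  using assms
proof (induction n arbitrary: a b)
  case 0
  then have "{a..<b} = {}" by simp
  then show ?case using eliminable_empty alpha_at_most_empty by metis
next
  case (Suc n)
  let ?E = "path_arcs k"
  let ?Q = "\<lambda>m S. \<forall>T\<subseteq>{m}. alpha_at_most ?E (Suc n) (T \<union> S)"
  have empty: "eliminable ?E {} (?Q m)" for m
  proof (intro eliminable_empty allI impI)
    fix T assume "T \<subseteq> {m}"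
    then have "finite T" "card T \<le> Suc n"
      using finite_subset card_mono[of "{m}" T] by auto
    then show "alpha_at_most ?E (Suc n) (T \<union> {})" by (simp add: alpha_at_most_card)
  qed
  show ?case
  proof (cases "a < b")
    case False
    then have "{a..<b} = {}" by simp
    then show ?thesis
      using eliminable_empty alpha_at_most_empty by metis
  next
    case True
    have pow: "3 * 2 ^ n \<ge> (3::nat)" by simp
    \<comment> \<open>the part left of \<open>m\<close> and the part right of it have at most \<open>h n + 1\<close> vertices\<close>
    define m where "m = min (a + 3 * 2 ^ n - 2) (b - 1)"
    have m: "a \<le> m" "m < b" using True pow unfolding m_def by linarith+
    have left: "m + 2 \<le> a + 3 * 2 ^ n" using pow unfolding m_def by linarith
    have right: "b + 2 \<le> Suc m + 3 * 2 ^ n" using pow Suc.prems(2) m unfolding m_def power_Suc by linarith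
    have "eliminable ?E {a..<m} (?Q m)"
    proof (cases "a < m")
      case False
      then have "{a..<m} = {}" by simp
      then show ?thesis using empty[of m] by (simp only:)
    next
      case True
      then have eq: "{a..<m} = insert (m - 1) {a..<m - 1}" by auto
      show ?thesis unfolding eq
      proof (rule eliminable_edge_top)
        show "(m, m - 1) \<in> ?E" using True m Suc.prems(1) by (auto simp: path_arcs_iff)
        show "eliminable ?E {a..<m - 1} (alpha_at_most ?E n)"
          by (rule Suc.IH) (use True left m Suc.prems(1) in auto)
      qed auto
    qed
    moreover have "eliminable ?E {Suc m..<b} (?Q m)"
    proof (cases "Suc m < b")
      case False
      then have "{Suc m..<b} = {}" by simp
      then show ?thesis using empty[of m] by (simp only:)
    next
      case True
      then have eq: "{Suc m..<b} = insert (Suc m) {Suc (Suc m)..<b}" by auto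
      show ?thesis unfolding eq
      proof (rule eliminable_edge_top)
        show "(m, Suc m) \<in> ?E" using True m Suc.prems(1) by (auto simp: path_arcs_iff)
        show "eliminable ?E {Suc (Suc m)..<b} (alpha_at_most ?E n)"
          by (rule Suc.IH) (use True right m Suc.prems(1) in auto)
      qed auto
    qed
    ultimately have "eliminable ?E ({a..<m} \<union> {Suc m..<b}) (?Q m)"
      by (rule eliminable_Un) (auto simp: path_arcs_iff)
    moreover have "{a..<b} - {m} = {a..<m} \<union> {Suc m..<b}" using m by auto
    ultimately show ?thesis
      using eliminable_top[of "{m}" "{a..<b}" ?E "alpha_at_most ?E (Suc n)"] m by simp
  qed
qed

text \<open>
  A connected set lies in a single tree and has a root in it. Walking along the path from a vertex
  with a shortest label, the next label is comparable with the current one, which extends the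
  shortest label; not being shorter, the next label extends the shortest label as well.
\<close>

lemma common_prefix_of_interval:
  assumes edge: "\<And>i. a \<le> i \<Longrightarrow> Suc i < b \<Longrightarrow> comparable (f i) (f (Suc i))"
    and r: "r \<in> {a..<b}" and least: "\<And>i. i \<in> {a..<b} \<Longrightarrow> length (f r) \<le> length (f i)"
    and i: "i \<in> {a..<b}"
  shows "prefix (f r) (f i)"
proof -
  have move: "prefix (f r) (f w)"
    if "prefix (f r) (f u)" "comparable (f u) (f w)" "w \<in> {a..<b}" for u w
    using that least[of w] by (meson prefix_length_prefix prefix_order.order_trans)
  show ?thesis
  proof (cases "r \<le> i")
    case True
    then show ?thesis using i
    proof (induction i rule: dec_induct)
      case (step j)
      then show ?case using move[of j "Suc j"] edge[of j] r by auto
    qed simp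
  next
    case False
    then have "i \<le> r" by simp
    then show ?thesis using i
    proof (induction i rule: inc_induct)
      case (step j)
      then show ?case using move[of "Suc j" j] edge[of j] r by auto
    qed simp
  qed
qed

text \<open>
  The matching upper bound \<open>h (n + 1) \<le> 2 h n + 3\<close>. Let \<open>r\<close> be the root of the interval. An independent
  chain among the vertices that are neither \<open>r\<close> nor adjacent to \<open>r\<close> remains an independent chain
  when \<open>r\<close> is added. So the two intervals that remain without \<open>r - 1\<close>, \<open>r\<close> and \<open>r + 1\<close> have
  depth \<open>n\<close>.
\<close>

lemma labelled_interval_length:
  assumes "b \<le> k" "elimination_labelling (path_arcs k) {a..<b} (alpha_at_most (path_arcs k) n) f"
  shows "b - a + 3 \<le> 3 * 2 ^ n"
  using assms
proof (induction n arbitrary: a b)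
  case 0
  note lab = elimination_labellingD[OF 0(2)]
  have "\<not> a < b"
  proof
    assume "a < b"
    then have "alpha_at_most (path_arcs k) 0 {a}"
      by (intro lab(3)) (auto simp: label_chain_def)
    then have "card {a} \<le> 0" unfolding alpha_at_most_def
      by (elim allE[of _ "{a}"]) (auto simp: independent_def path_arcs_iff)
    then show False by simp
  qed
  then show ?case by simp
next
  case (Suc n)
  let ?E = "path_arcs k"
  note lab = elimination_labellingD[OF Suc.prems(2)]
  show ?case
  proof (cases "a < b")
    case False
    then show ?thesis using self_le_power[of 2 n] by simp
  next
    case True
    define r where "r = arg_min_on (length \<circ> f) {a..<b}"
    have r: "r \<in> {a..<b}" using arg_min_if_finite(1)[of "{a..<b}"] True by (simp add: r_def)
    have least: "length (f r) \<le> length (f i)" if "i \<in> {a..<b}" for i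
      using arg_min_least[of "{a..<b}" i "length \<circ> f"] that True by (auto simp: r_def)
    have top: "prefix (f r) (f i)" if "i \<in> {a..<b}" for i
      by (rule common_prefix_of_interval[of a b f]) (use r least that lab(2) Suc.prems(1) in \<open>auto simp: path_arcs_iff\<close>)
    have part: "elimination_labelling ?E {c..<d} (alpha_at_most ?E n) f"
      if cd: "{c..<d} \<subseteq> {a..<b}" and far: "\<And>i. i \<in> {c..<d} \<Longrightarrow> Suc i < r \<or> Suc r < i" for c d
      unfolding elimination_labelling_def
    proof (intro conjI ballI allI impI)
      show "inj_on f {c..<d}" using lab(1) cd by (rule inj_on_subset)
      show "comparable (f u) (f v)" if "u \<in> {c..<d}" "v \<in> {c..<d}" "(u, v) \<in> ?E" for u v
        using lab(2)[of u v] that cd by blast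
      fix S assume S: "S \<subseteq> {c..<d}" "label_chain f S"
      then have "label_chain f (insert r S)" using top cd r unfolding label_chain_def by blast
      then have alpha: "alpha_at_most ?E (Suc n) (insert r S)" using S(1) cd r by (intro lab(3)) auto
      show "alpha_at_most ?E n S" unfolding alpha_at_most_def
      proof (intro allI impI)
        fix T assume T: "T \<subseteq> S" "independent ?E T"
        have farT: "Suc i < r \<or> Suc r < i" if "i \<in> T" for i using that T(1) S(1) far by blast
        then have "independent ?E (insert r T)"
          using T(2) by (fastforce simp: independent_def path_arcs_iff)
        then have "card (insert r T) \<le> Suc n"
          using alpha T(1) unfolding alpha_at_most_def by blast
        moreover have "r \<notin> T" using farT by fastforce
        moreover have "finite T" using T(1) S(1) finite_subset finite_atLeastLessThan by metis
        ultimately show "card T \<le> n" by simp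
      qed
    qed
    \<comment> \<open>for \<open>r = 0\<close> truncated subtraction gives the empty interval on the left\<close>
    have "r - 1 - a + 3 \<le> 3 * 2 ^ n"
      by (rule Suc.IH[OF _ part]) (use r Suc.prems(1) in auto)
    moreover have "b - (r + 2) + 3 \<le> 3 * 2 ^ n"
      by (rule Suc.IH[OF _ part]) (use r Suc.prems(1) in auto)
    ultimately show ?thesis using r by simp
  qed
qed

section \<open>Gyarfas' path argument\<close>

definition induced_path :: "'a rel \<Rightarrow> 'a set \<Rightarrow> 'a list \<Rightarrow> bool" where
  "induced_path E V p \<longleftrightarrow> set p \<subseteq> V \<and> distinct p \<and>
     (\<forall>i<length p. \<forall>j<length p. (p ! i, p ! j) \<in> E \<longleftrightarrow> j = Suc i \<or> i = Suc j)"

lemma induced_path_single: "v \<in> V \<Longrightarrow> (v, v) \<notin> E \<Longrightarrow> induced_path E V [v]"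
  by (simp add: induced_path_def)

lemma induced_path_snoc:
  assumes "sym E" and w: "w \<in> V" "w \<notin> set (q @ [v])" "(w, w) \<notin> E" "(v, w) \<in> E"
    and p: "induced_path E V (q @ [v])" and far: "\<And>x. x \<in> set q \<Longrightarrow> (x, w) \<notin> E"
  shows "induced_path E V ((q @ [v]) @ [w])"
proof -
  let ?p = "q @ [v]" and ?n = "length q"
  have adj: "(?p ! i, w) \<in> E \<longleftrightarrow> i = ?n" if "i < Suc ?n" for i
  proof (cases "i = ?n")
    case False
    then have "?p ! i \<in> set q" using that by (simp add: nth_append)
    then show ?thesis using far False by blast
  qed (use w(4) in simp)
  have "((?p @ [w]) ! i, (?p @ [w]) ! j) \<in> E \<longleftrightarrow> j = Suc i \<or> i = Suc j"
    if ij: "i < Suc (Suc ?n)" "j < Suc (Suc ?n)" for i j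
  proof -
    have old: "(?p @ [w]) ! i = ?p ! i" if "i < Suc ?n" for i using that by (simp add: nth_append)
    have new: "(?p @ [w]) ! Suc ?n = w" by (simp add: nth_append)
    consider "i < Suc ?n" "j < Suc ?n" | "i < Suc ?n" "j = Suc ?n"
      | "i = Suc ?n" "j < Suc ?n" | "i = Suc ?n" "j = Suc ?n" using ij by linarith
    then show ?thesis
    proof cases
      case 1
      then show ?thesis using p by (simp only: old) (simp add: induced_path_def)
    next
      case 2
      then show ?thesis using adj[of i] by (simp only: old new) auto
    next
      case 3
      then show ?thesis using adj[of j] symD[OF assms(1)] by (simp only: old new) auto
    next
      case 4
      then show ?thesis using w(3) by (simp only: new) auto
    qed
  qed
  then show ?thesis using p w(1,2) by (auto simp: induced_path_def)
qed

text \<open>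
  One step of Gyarfas' path argument. The part of the closed neighbourhood of \<open>v\<close> inside \<open>C\<close> goes on
  top and costs \<open>s\<close>. The remaining components \<open>D\<close> have no edge to \<open>v\<close>, and since \<open>v\<close> together with
  \<open>C\<close> is connected, each of them is adjacent to some neighbour \<open>w\<close> of \<open>v\<close> through which the path can
  be continued.
\<close>

lemma eliminable_remove_closed_neighbourhood:
  assumes "finite C" "sym E"
    and nbhd: "alpha_at_most E s {x \<in> C. x = v \<or> (v, x) \<in> E}"
    and conn: "connected_in E (insert v C)"
    and rest: "\<And>w x D. w \<in> C \<Longrightarrow> (v, w) \<in> E \<Longrightarrow> x \<in> D \<Longrightarrow> (w, x) \<in> E \<Longrightarrow>
      D \<subseteq> C \<Longrightarrow> v \<notin> D \<Longrightarrow> (\<And>y. y \<in> D \<Longrightarrow> (v, y) \<notin> E) \<Longrightarrow> connected_in E (insert w D) \<Longrightarrow>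
      eliminable E D (alpha_at_most E m)"
  shows "eliminable E C (alpha_at_most E (s + m))"
proof (rule eliminable_top)
  let ?X = "{x \<in> C. x = v \<or> (v, x) \<in> E}"
  show "finite ?X" using \<open>finite C\<close> by simp
  show "?X \<subseteq> C" by auto
  have "eliminable E (C - ?X) (alpha_at_most E m)"
  proof (rule eliminable_components[of _ _ "alpha_at_most E m"])
    show "sym E" by fact
    show "alpha_at_most E m {}" by (rule alpha_at_most_empty)
    show "finite (C - ?X)" using \<open>finite C\<close> by simp
    fix D assume D: "D \<subseteq> C - ?X" "D \<noteq> {}" "connected_in E D"
      "\<And>x y. x \<in> D \<Longrightarrow> y \<in> C - ?X - D \<Longrightarrow> (x, y) \<notin> E"
    have vD: "v \<notin> D" and vE: "\<And>y. y \<in> D \<Longrightarrow> (v, y) \<notin> E" using D(1) by auto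
    have "D \<subseteq> insert v C" "D \<noteq> insert v C" using D(1) vD by auto
    then obtain x w where xw: "x \<in> D" "w \<in> insert v C - D" "(x, w) \<in> E"
      using conn D(2) unfolding connected_in_def by meson
    have wx: "(w, x) \<in> E" using xw(3) \<open>sym E\<close> by (rule symD[rotated])
    have "w \<noteq> v" using vE xw(1) wx by blast
    then have wC: "w \<in> C" using xw(2) by blast
    have vw: "(v, w) \<in> E" using D(4)[OF xw(1), of w] xw wC \<open>w \<noteq> v\<close> by blast
    have "connected_in E (insert w D)"
      unfolding connected_in_def
    proof (intro allI impI)
      fix T assume T: "T \<subseteq> insert w D" "T \<noteq> {}" "T \<noteq> insert w D"
      consider "T \<inter> D = {}" | "D \<subseteq> T" | "T \<inter> D \<noteq> {}" "T \<inter> D \<noteq> D" by blast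
      then show "\<exists>x\<in>T. \<exists>y\<in>insert w D - T. (x, y) \<in> E"
      proof cases
        case 1
        then have "T = {w}" using T by blast
        then show ?thesis using wx xw(1,2) by blast
      next
        case 2
        then have "w \<notin> T" using T by blast
        then show ?thesis using 2 xw(1,3) by blast
      next
        case 3
        then obtain x y where "x \<in> T \<inter> D" "y \<in> D - T \<inter> D" "(x, y) \<in> E"
          using D(3) unfolding connected_in_def by (meson Int_lower2)
        then show ?thesis by blast
      qed
    qed
    then show "eliminable E D (alpha_at_most E m)"
      using rest[of w x D] wC vw xw(1) wx D(1) vD vE by blast
  qed
  then show "eliminable E (C - ?X) (\<lambda>S. \<forall>T\<subseteq>?X. alpha_at_most E (s + m) (T \<union> S))"
  proof (rule eliminable_weaken, intro allI impI)
    fix S T assume S: "alpha_at_most E m S" and T: "T \<subseteq> ?X"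
    have "alpha_at_most E s T" using nbhd T by (rule alpha_at_most_mono[OF _ order_refl])
    then show "alpha_at_most E (s + m) (T \<union> S)" using S by (rule alpha_at_most_Un)
  qed
qed

text \<open>
  The path \<open>q @ [v]\<close> has been built, and \<open>C\<close> is a part of the graph that it can still reach, but only
  through its last vertex. As long as components remain, the path grows by one vertex per removed
  neighbourhood; since \<open>k\<close> vertices are never reached, at most \<open>j + 1\<close> neighbourhoods are removed.
\<close>

lemma eliminable_beyond_induced_path:
  assumes "finite V" "sym E" "irrefl E"
    and nbhd: "\<And>v. v \<in> V \<Longrightarrow> alpha_at_most E s {x \<in> V. x = v \<or> (v, x) \<in> E}"
    and no_path: "\<And>p. induced_path E V p \<Longrightarrow> length p \<noteq> k"
  shows "length q + 3 + j = k \<Longrightarrow> induced_path E V (q @ [v]) \<Longrightarrow> C \<subseteq> V \<Longrightarrow>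
    connected_in E (insert v C) \<Longrightarrow> set q \<inter> C = {} \<Longrightarrow>
    (\<And>x y. x \<in> set q \<Longrightarrow> y \<in> C - {v} \<Longrightarrow> (x, y) \<notin> E) \<Longrightarrow>
    eliminable E C (alpha_at_most E (s * Suc j))"
proof (induction j arbitrary: q v C)
  case (0 q v C)
  have irr: "(x, x) \<notin> E" for x using assms(3) by (simp add: irrefl_def)
  have "finite C" using 0(3) assms(1) by (rule finite_subset)
  moreover have "alpha_at_most E s {x \<in> C. x = v \<or> (v, x) \<in> E}"
    by (rule alpha_at_most_mono[OF nbhd[of v] order_refl]) (use 0(2,3) in \<open>auto simp: induced_path_def\<close>)
  ultimately have "eliminable E C (alpha_at_most E (s + 0))"
  proof (rule eliminable_remove_closed_neighbourhood[OF _ assms(2) _ 0(4)])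
    \<comment> \<open>a remaining component would extend the path by two vertices, to length \<open>k\<close>\<close>
    fix w x D assume w: "w \<in> C" "(v, w) \<in> E" and x: "x \<in> D" "(w, x) \<in> E"
      and D: "D \<subseteq> C" "v \<notin> D" "\<And>y. y \<in> D \<Longrightarrow> (v, y) \<notin> E"
    have wv: "w \<noteq> v" "x \<noteq> w" "x \<noteq> v" using w(2) x irr D(2) by auto
    have "induced_path E V ((q @ [v]) @ [w])"
      by (rule induced_path_snoc[OF assms(2)]) (use 0 w wv irr in auto)
    then have "induced_path E V (((q @ [v]) @ [w]) @ [x])"
      by (rule induced_path_snoc[OF assms(2), rotated -2])
        (use 0 x D wv irr in auto)
    then show "eliminable E D (alpha_at_most E 0)" using no_path 0(1) by fastforce
  qed
  then show ?case by simp
next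
  case (Suc j q v C)
  have irr: "(x, x) \<notin> E" for x using assms(3) by (simp add: irrefl_def)
  have "finite C" using Suc.prems(3) assms(1) by (rule finite_subset)
  moreover have "alpha_at_most E s {x \<in> C. x = v \<or> (v, x) \<in> E}"
    by (rule alpha_at_most_mono[OF nbhd[of v] order_refl])
      (use Suc.prems(2,3) in \<open>auto simp: induced_path_def\<close>)
  ultimately have "eliminable E C (alpha_at_most E (s + s * Suc j))"
  proof (rule eliminable_remove_closed_neighbourhood[OF _ assms(2) _ Suc.prems(4)])
    fix w x D assume w: "w \<in> C" "(v, w) \<in> E" and x: "x \<in> D" "(w, x) \<in> E"
      and D: "D \<subseteq> C" "v \<notin> D" "\<And>y. y \<in> D \<Longrightarrow> (v, y) \<notin> E" "connected_in E (insert w D)"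
    have wv: "w \<noteq> v" using w(2) irr by auto
    have "induced_path E V ((q @ [v]) @ [w])"
      by (rule induced_path_snoc[OF assms(2)]) (use Suc.prems w wv irr in auto)
    moreover have "(x, y) \<notin> E" if "x \<in> set (q @ [v])" "y \<in> D - {w}" for x y
      using that D(1-3) Suc.prems(6)[of x y] by auto
    ultimately show "eliminable E D (alpha_at_most E (s * Suc j))"
      using Suc.prems(1,3,5) D(1,2,4) by (intro Suc.IH[of "q @ [v]" w D]) auto
  qed
  then show ?case by simp
qed

theorem eliminable_of_no_induced_path:
  assumes "finite V" "sym E" "irrefl E"
    and nbhd: "\<And>v. v \<in> V \<Longrightarrow> alpha_at_most E s {x \<in> V. x = v \<or> (v, x) \<in> E}"
    and no_path: "\<And>p. induced_path E V p \<Longrightarrow> length p \<noteq> k" and k: "k \<ge> 3"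
  shows "eliminable E V (alpha_at_most E (s * (k - 2)))"
proof (rule eliminable_components[OF assms(1,2)])
  show "alpha_at_most E (s * (k - 2)) {}" by (simp add: alpha_at_most_def)
  fix D assume D: "D \<subseteq> V" "D \<noteq> {}" "connected_in E D"
  then obtain v where v: "v \<in> D" by blast
  \<comment> \<open>the path starts as \<open>[v]\<close>, with \<open>v\<close> itself still to be removed\<close>
  have "eliminable E D (alpha_at_most E (s * Suc (k - 3)))"
    by (rule eliminable_beyond_induced_path[OF assms(1-5), where q = "[]" and v = v])
      (use D v k assms(3) in \<open>auto simp: insert_absorb irrefl_def intro!: induced_path_single\<close>)
  moreover have "Suc (k - 3) = k - 2" using k by simp
  ultimately show "eliminable E D (alpha_at_most E (s * (k - 2)))"
    by simp
qed

section \<open>The forest of a labelling\<close>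

lemma vwalk_snocD:
  assumes "vwalk (p @ [w]) G" "p \<noteq> []"
  shows "vwalk p G" "(last p, w) \<in> arcs_ends G" "w \<in> verts G"
  using assms vwalkI_append_l[OF assms(2,1)] by (auto simp: vwalk_def set_vwalk_arcs_snoc)

lemma vwalk_snocI:
  assumes "vwalk p G" "(last p, w) \<in> arcs_ends G" "w \<in> verts G"
  shows "vwalk (p @ [w]) G"
  using assms by (auto simp: vwalk_def set_vwalk_arcs_snoc)

lemma pcas_nth:
  assumes "pcas u p w"
  shows "p \<noteq> [] \<Longrightarrow> fst (p ! 0) = u" and "p \<noteq> [] \<Longrightarrow> snd (p ! (length p - 1)) = w"
    and "Suc i < length p \<Longrightarrow> fst (p ! Suc i) = snd (p ! i)"
proof -
  show "p \<noteq> [] \<Longrightarrow> fst (p ! 0) = u" using assms by (cases p) auto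
  show "p \<noteq> [] \<Longrightarrow> snd (p ! (length p - 1)) = w" using assms
  proof (induction p arbitrary: u)
    case (Cons e p)
    then show ?case by (cases p) auto
  qed simp
  show "Suc i < length p \<Longrightarrow> fst (p ! Suc i) = snd (p ! i)" using assms
  proof (induction p arbitrary: u i)
    case (Cons e p)
    then show ?case by (cases p; cases i) auto
  qed simp
qed

lemma tl_pawalk_verts: "pcas u p w \<Longrightarrow> tl (pawalk_verts u p) = map snd p"
proof (induction p arbitrary: u)
  case (Cons e p)
  then show ?case by (cases p) auto
qed simp

locale vertex_labelling =
  fixes V :: "'a set" and f :: "'a \<Rightarrow> 'a list"
  assumes finite_V: "finite V" and inj_f: "inj_on f V"
begin

text \<open>
  The parent carries the longest label among the proper ancestors; asking that it extends the labels
  of all proper ancestors makes its uniqueness immediate.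
\<close>

definition parent :: "'a \<Rightarrow> 'a \<Rightarrow> bool" where
  "parent u v \<longleftrightarrow> u \<in> V \<and> v \<in> V \<and> strict_prefix (f u) (f v) \<and>
     (\<forall>w\<in>V. strict_prefix (f w) (f v) \<longrightarrow> prefix (f w) (f u))"

definition tree_order_forest :: "'a pair_pre_digraph" where
  "tree_order_forest = \<lparr> pverts = V, parcs = {(u, v). parent u v \<or> parent v u} \<rparr>"

definition tree_order_roots :: "'a set" where
  "tree_order_roots = {v \<in> V. \<forall>u\<in>V. \<not> strict_prefix (f u) (f v)}"

definition below :: "'a \<Rightarrow> 'a set" where
  "below v = {u \<in> V. prefix (f u) (f v)}"

lemma parent_unique: "parent u v \<Longrightarrow> parent u' v \<Longrightarrow> u = u'"
  using inj_f unfolding parent_def by (metis inj_on_def prefix_order.order_antisym)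

lemma below_parent:
  assumes "parent u v" shows "below v = insert v (below u)"
proof -
  have "w \<in> below v \<longleftrightarrow> w = v \<or> w \<in> below u" if "w \<in> V" for w
  proof -
    have "f w = f v \<longleftrightarrow> w = v" using inj_f assms that unfolding parent_def by (meson inj_onD)
    moreover have "prefix (f w) (f v)" if "prefix (f w) (f u)"
      using assms that unfolding parent_def by auto
    ultimately show ?thesis
      using assms that unfolding below_def parent_def by (auto simp: strict_prefix_def)
  qed
  moreover have "v \<in> V" using assms by (simp add: parent_def)
  ultimately show ?thesis by (auto simp: below_def)
qed

lemma below_root: "v \<in> tree_order_roots \<Longrightarrow> below v = {v}"
  using inj_f by (auto simp: below_def tree_order_roots_def strict_prefix_def dest: inj_onD)

lemma obtain_parent:
  assumes "v \<in> V" "v \<notin> tree_order_roots"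
  obtains u where "parent u v"
proof -
  let ?S = "{u \<in> V. strict_prefix (f u) (f v)}"
  have S: "finite ?S" "?S \<noteq> {}" using assms finite_V by (auto simp: tree_order_roots_def)
  have "Max ((\<lambda>u. length (f u)) ` ?S) \<in> (\<lambda>u. length (f u)) ` ?S"
    by (rule Max_in) (use S in auto)
  then obtain u where u: "u \<in> ?S" and "Max ((\<lambda>u. length (f u)) ` ?S) = length (f u)" by auto
  then have max: "length (f w) \<le> length (f u)" if "w \<in> ?S" for w
    using S(1) that by (metis (mono_tags, lifting) Max_ge finite_imageI imageI)
  have "prefix (f w) (f u)" if "w \<in> V" "strict_prefix (f w) (f v)" for w
    using that max[of w] u prefix_length_prefix[of "f w" "f v" "f u"] by (simp add: strict_prefix_def)
  then have "parent u v" using u assms(1) by (simp add: parent_def)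
  then show thesis by (rule that)
qed

lemma tree_order_forest_sel [simp]:
  "pverts tree_order_forest = V"
  "(u, v) \<in> parcs tree_order_forest \<longleftrightarrow> parent u v \<or> parent v u"
  by (simp_all add: tree_order_forest_def)

sublocale F: pair_graph tree_order_forest
proof
  show "finite (pverts tree_order_forest)" using finite_V by simp
  have "parcs tree_order_forest \<subseteq> V \<times> V" by (auto simp: parent_def)
  then show "finite (parcs tree_order_forest)" using finite_V finite_subset by blast
  show "symmetric (with_proj tree_order_forest)" by (auto simp: symmetric_def sym_def)
qed (auto simp: parent_def)

text \<open>
  A path that starts in a root only ever goes up: a step back would lead from a vertex to its
  parent, and by induction that has already been visited.
\<close>

lemma path_from_root:
  assumes "vpath p (with_proj tree_order_forest)" "hd p \<in> tree_order_roots"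
  shows "set p = below (last p)"
  using assms
proof (induction p rule: rev_induct)
  case Nil
  then show ?case by (simp add: vpath_def vwalk_def)
next
  case (snoc w q)
  show ?case
  proof (cases "q = []")
    case True
    then show ?thesis using snoc.prems below_root by simp
  next
    case False
    have walk: "vwalk (q @ [w]) (with_proj tree_order_forest)" and dist: "distinct (q @ [w])"
      using snoc.prems(1) by (auto simp: vpath_def)
    have q: "set q = below (last q)"
      by (rule snoc.IH) (use vwalk_snocD(1)[OF walk False] dist snoc.prems(2) False in \<open>auto simp: vpath_def\<close>)
    have "parent (last q) w \<or> parent w (last q)" using vwalk_snocD(2)[OF walk False] by simp
    moreover have "\<not> parent w (last q)"
    proof
      assume "parent w (last q)"
      then have "w \<in> set q" using q by (auto simp: below_def parent_def)
      then show False using dist by simp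
    qed
    ultimately show ?thesis using q below_parent by auto
  qed
qed

lemma obtain_path_from_root:
  assumes "v \<in> V"
  obtains p where "vpath p (with_proj tree_order_forest)" "hd p \<in> tree_order_roots" "last p = v"
proof -
  have "\<exists>p. vpath p (with_proj tree_order_forest) \<and> hd p \<in> tree_order_roots \<and> last p = v"
    using assms
  proof (induction "length (f v)" arbitrary: v rule: less_induct)
    case less
    show ?case
    proof (cases "v \<in> tree_order_roots")
      case True
      then show ?thesis using less.prems
        by (intro exI[of _ "[v]"]) (auto simp: vpath_def vwalk_def)
    next
      case False
      then obtain u where u: "parent u v" using obtain_parent less.prems by blast
      then have "length (f u) < length (f v)" "u \<in> V" by (auto simp: parent_def prefix_length_less)
      then obtain p where p: "vpath p (with_proj tree_order_forest)" "hd p \<in> tree_order_roots" "last p = u"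
        using less.hyps by blast
      then have "p \<noteq> []" by (auto simp: vpath_def vwalk_def)
      have "v \<notin> set p"
        using path_from_root[OF p(1,2)] p(3) u by (auto simp: below_def parent_def)
      then have "vpath (p @ [v]) (with_proj tree_order_forest)"
        using p u less.prems by (auto simp: vpath_def intro!: vwalk_snocI)
      then show ?thesis using p(2) \<open>p \<noteq> []\<close> by (intro exI[of _ "p @ [v]"]) simp
    qed
  qed
  then show thesis using that by blast
qed

text \<open>
  In a cycle consider a vertex with a longest label. Both neighbours on the cycle are its parent,
  hence they are equal, which is impossible if the cycle has at least three vertices.
\<close>

lemma no_long_cycle:
  assumes "pre_digraph.cycle (with_proj tree_order_forest) p"
  shows "length p < 3"
proof (rule ccontr)
  assume "\<not> length p < 3"
  then have n: "length p \<ge> 3" by simp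
  from assms obtain u where u: "set p \<subseteq> parcs tree_order_forest" "pcas u p u"
    "distinct (tl (pawalk_verts u p))" "p \<noteq> []"
    by (auto simp: F.cycle_def F.awalk_def)
  note nth = pcas_nth[OF u(2)]
  \<comment> \<open>cyclic successor: the arc \<open>p ! nxt i\<close> starts where the arc \<open>p ! i\<close> ends\<close>
  define nxt where "nxt i = (if Suc i < length p then Suc i else 0)" for i
  have nxt: "fst (p ! nxt i) = snd (p ! i)" if "i < length p" for i
  proof (cases "Suc i < length p")
    case False
    then have "i = length p - 1" using that by simp
    then show ?thesis using nth(1,2) u(4) False by (simp add: nxt_def)
  qed (simp add: nxt_def nth(3))
  have dist: "snd (p ! i) \<noteq> snd (p ! j)" if "i < length p" "j < length p" "i \<noteq> j" for i j
  proof -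
    have "distinct (map snd p)" using u(2,3) tl_pawalk_verts by metis
    then show ?thesis using that by (auto simp: distinct_conv_nth)
  qed
  let ?h = "\<lambda>i. length (f (snd (p ! i)))"
  have "{..<length p} \<noteq> {}" using u(4) by (auto simp: lessThan_empty_iff)
  then have "Max (?h ` {..<length p}) \<in> ?h ` {..<length p}" by (intro Max_in) auto
  then obtain i where i: "i < length p" "?h i = Max (?h ` {..<length p})" by auto
  then have max: "?h j \<le> ?h i" if "j < length p" for j using that by simp
  define h where "h = (if i = 0 then length p - 1 else i - 1)"
  have h: "h < length p" "nxt h = i" using i(1) n by (auto simp: h_def nxt_def)
  have j: "nxt i < length p" using u(4) by (simp add: nxt_def)
  have neq: "h \<noteq> nxt i" using i(1) n by (auto simp: h_def nxt_def)
  have arc: "parent (fst (p ! k)) (snd (p ! k)) \<or> parent (snd (p ! k)) (fst (p ! k))"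
    if "k < length p" for k
    using u(1) nth_mem[OF that] tree_order_forest_sel(2) by (metis prod.collapse subsetD)
  have shorter: "\<not> parent (snd (p ! i)) (snd (p ! k))" if "k < length p" for k
    using max[OF that] by (auto simp: parent_def dest: prefix_length_less)
  have "parent (snd (p ! h)) (snd (p ! i))"
    using arc[OF i(1)] nxt[OF h(1)] h(2) shorter[OF h(1)] by auto
  moreover have "parent (snd (p ! nxt i)) (snd (p ! i))"
    using arc[OF j] nxt[OF i(1)] shorter[OF j] by auto
  ultimately show False using parent_unique dist[OF h(1) j neq] by blast
qed

lemma rooted_tree_order_forest: "rooted_forest tree_order_forest tree_order_roots"
  unfolding rooted_forest_def
proof (intro conjI ballI)
  show "undirected_forest tree_order_forest"
    using no_long_cycle F.pair_graph by (force simp: undirected_forest_def)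
  show "tree_order_roots \<subseteq> pverts tree_order_forest" by (auto simp: tree_order_roots_def)
  fix C assume C: "C \<in> pre_digraph.sccs_verts (with_proj tree_order_forest)"
  then have conn: "a \<rightarrow>\<^sup>*\<^bsub>with_proj tree_order_forest\<^esub> b" if "a \<in> C" "b \<in> C" for a b
    using that by (simp add: F.in_sccs_verts_conv_reachable)
  obtain v where v: "v \<in> C" using C unfolding F.in_sccs_verts_conv_reachable by auto
  then have "v \<rightarrow>\<^sup>*\<^bsub>with_proj tree_order_forest\<^esub> v" using conn by simp
  then have "v \<in> V" using F.reachable_in_verts by auto
  then obtain p where p: "vpath p (with_proj tree_order_forest)" "hd p \<in> tree_order_roots" "last p = v"
    by (rule obtain_path_from_root)
  have r: "hd p \<rightarrow>\<^sup>*\<^bsub>with_proj tree_order_forest\<^esub> v" using p F.reachable_vpath_conv by blast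
  then have "v \<rightarrow>\<^sup>*\<^bsub>with_proj tree_order_forest\<^esub> hd p" by (rule F.symmetric_reachable')
  then have "hd p \<in> C" using r v C by (auto simp: F.in_sccs_verts_conv_reachable)
  show "\<exists>!r. r \<in> tree_order_roots \<inter> C"
  proof (rule ex1I)
    show "hd p \<in> tree_order_roots \<inter> C" using \<open>hd p \<in> C\<close> p(2) by blast
    fix r assume r: "r \<in> tree_order_roots \<inter> C"
    then have "hd p \<rightarrow>\<^sup>*\<^bsub>with_proj tree_order_forest\<^esub> r" using conn \<open>hd p \<in> C\<close> by simp
    then obtain q where q: "vpath q (with_proj tree_order_forest)" "hd q = hd p" "last q = r"
      using F.reachable_vpath_conv by blast
    then have "set q = {r}" using path_from_root[OF q(1)] p(2) r below_root by simp
    moreover have "hd q \<in> set q" using q(1) by (auto simp: vpath_def vwalk_def)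
    ultimately show "r = hd p" using q(2) by simp
  qed
qed

lemma root_to_leaf_path_chain:
  assumes "root_to_leaf_path tree_order_forest tree_order_roots p"
  shows "set p \<subseteq> V" "label_chain f (set p)"
proof -
  have "set p = below (last p)" using assms path_from_root by (simp add: root_to_leaf_path_def)
  then show "set p \<subseteq> V" "label_chain f (set p)"
    using prefix_same_cases by (auto simp: below_def label_chain_def)
qed

text \<open>
  A vertex above \<open>v\<close> with a longest label is a leaf.
\<close>

lemma obtain_root_to_leaf_path:
  assumes "v \<in> V"
  obtains p where "root_to_leaf_path tree_order_forest tree_order_roots p" "below v \<subseteq> set p"
proof -
  let ?S = "{w \<in> V. prefix (f v) (f w)}"
  let ?len = "\<lambda>w. length (f w)"
  have "Max (?len ` ?S) \<in> ?len ` ?S" by (rule Max_in) (use assms finite_V in auto)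
  then obtain w where w: "w \<in> ?S" and wmax: "?len w = Max (?len ` ?S)" by auto
  have max: "?len x \<le> ?len w" if "x \<in> ?S" for x using that finite_V by (auto simp: wmax)
  obtain p where p: "vpath p (with_proj tree_order_forest)" "hd p \<in> tree_order_roots" "last p = w"
    using w obtain_path_from_root by blast
  have setp: "set p = below w" using path_from_root[OF p(1,2)] p(3) by simp
  have "\<not> descendant tree_order_forest tree_order_roots w x" for x
  proof
    assume "descendant tree_order_forest tree_order_roots w x"
    then obtain q where q: "x \<noteq> w" "vpath q (with_proj tree_order_forest)"
      "hd q \<in> tree_order_roots" "last q = x" "w \<in> set q" by (auto simp: descendant_def)
    have "x \<in> set q" using q(2,4) by (auto simp: vpath_def vwalk_def)
    then have x: "x \<in> V" "prefix (f w) (f x)"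
      using path_from_root[OF q(2,3)] q(4,5) by (auto simp: below_def)
    then have "?len x \<le> ?len w" using w by (intro max) auto
    then have "f w = f x" using x(2) by (metis linorder_not_less prefix_length_less strict_prefix_def)
    then show False using q(1) x(1) w inj_f by (auto dest: inj_onD)
  qed
  then have "root_to_leaf_path tree_order_forest tree_order_roots p"
    using p by (simp add: root_to_leaf_path_def)
  moreover have "below v \<subseteq> set p"
  proof
    fix x assume "x \<in> below v"
    then have "x \<in> V" "prefix (f x) (f v)" by (simp_all add: below_def)
    moreover have "prefix (f v) (f w)" using w by simp
    ultimately have "x \<in> below w" unfolding below_def using prefix_order.order_trans by blast
    then show "x \<in> set p" using setp by simp
  qed
  ultimately show thesis by (rule that)
qed

end

lemma independence_number_le_iff:
  assumes "finite X" "X \<subseteq> pverts G"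
  shows "independence_number (with_proj G \<restriction> X) \<le> n \<longleftrightarrow> alpha_at_most (parcs G) n X"
proof -
  let ?A = "{S. S \<subseteq> X \<and> independent (parcs G) S}"
  let ?H = "with_proj G \<restriction> X"
  have ends: "(u, v) \<in> arcs_ends ?H \<longleftrightarrow> (u, v) \<in> parcs G \<and> u \<in> X \<and> v \<in> X" for u v
    by (auto simp: arcs_ends_conv)
  have "S \<subseteq> verts ?H \<and> (\<forall>u\<in>S. \<forall>v\<in>S. (u, v) \<notin> arcs_ends ?H) \<longleftrightarrow>
      S \<subseteq> X \<and> independent (parcs G) S" for S
    unfolding ends independent_def induce_subgraph_verts by blast
  then have eq: "{card S |S. S \<subseteq> verts ?H \<and> (\<forall>u\<in>S. \<forall>v\<in>S. (u, v) \<notin> arcs_ends ?H)} = card ` ?A"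
    by (simp only: setcompr_eq_image)
  have "finite ?A" using assms(1) by simp
  moreover have "{} \<in> ?A" by (simp add: independent_def)
  ultimately show ?thesis
    unfolding independence_number_def eq alpha_at_most_def by (subst Max_le_iff) blast+
qed

lemma alpha_depth_le_iff:
  assumes "finite (pverts G)" and "\<And>p. root_to_leaf_path F R p \<Longrightarrow> set p \<subseteq> pverts G"
  shows "alpha_depth G F R \<le> n \<longleftrightarrow>
    (\<forall>p. root_to_leaf_path F R p \<longrightarrow> alpha_at_most (parcs G) n (set p))"
proof -
  let ?A = "{independence_number (with_proj G \<restriction> set p) |p. root_to_leaf_path F R p}"
  have "?A \<subseteq> (\<lambda>X. independence_number (with_proj G \<restriction> X)) ` Pow (pverts G)"
    using assms(2) by auto
  then have "finite ?A" using assms(1) finite_subset by blast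
  then have "alpha_depth G F R \<le> n \<longleftrightarrow> (\<forall>a\<in>?A. a \<le> n)" by (simp add: alpha_depth_def)
  also have "\<dots> \<longleftrightarrow> (\<forall>p. root_to_leaf_path F R p \<longrightarrow>
      independence_number (with_proj G \<restriction> set p) \<le> n)" by blast
  finally show ?thesis using independence_number_le_iff assms(2) by (metis List.finite_set)
qed

lemma elimination_forest_of_labelling:
  assumes "pair_graph G"
    and "elimination_labelling (parcs G) (pverts G) (alpha_at_most (parcs G) n) f"
  obtains F R where "elimination_forest G F R" "alpha_depth G F R \<le> n"
proof -
  interpret G: pair_graph G by fact
  note lab = elimination_labellingD[OF assms(2)]
  interpret vertex_labelling "pverts G" f
    by unfold_locales (use lab(1) G.pair_finite_verts in auto)
  have "elimination_forest G tree_order_forest tree_order_roots"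
    unfolding elimination_forest_def
  proof (intro conjI ballI)
    show "rooted_forest tree_order_forest tree_order_roots" by (rule rooted_tree_order_forest)
    fix e assume e: "e \<in> parcs G"
    obtain u v where uv: "e = (u, v)" by (cases e)
    have V: "u \<in> pverts G" "v \<in> pverts G" using e uv G.wellformed' by auto
    then have "comparable (f u) (f v)" using lab(2) e uv by blast
    then obtain w where "w \<in> pverts G" "u \<in> below w" "v \<in> below w"
      using V by (auto simp: below_def)
    moreover then obtain p where "root_to_leaf_path tree_order_forest tree_order_roots p" "below w \<subseteq> set p"
      using obtain_root_to_leaf_path by blast
    ultimately show "case e of (u, v) \<Rightarrow>
        \<exists>p. root_to_leaf_path tree_order_forest tree_order_roots p \<and> u \<in> set p \<and> v \<in> set p"
      using uv by blast
  qed simp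
  moreover have "alpha_depth G tree_order_forest tree_order_roots \<le> n"
    using root_to_leaf_path_chain lab(3) by (subst alpha_depth_le_iff) (auto simp: G.pair_finite_verts)
  ultimately show thesis by (rule that)
qed

section \<open>The labelling of an elimination forest\<close>

lemma vwalk_rev:
  assumes "vwalk p G" "sym (arcs_ends G)"
  shows "vwalk (rev p) G"
  using assms by (auto simp: vwalk_def set_vwalk_arcs_rev dest: symD)

lemma awalk_of_vwalk:
  assumes "vwalk p (with_proj G)"
  shows "pcas (hd p) (vwalk_arcs p) (last p)" and "pawalk_verts (hd p) (vwalk_arcs p) = p"
  using assms by (induction p rule: vwalk_induct) auto

text \<open>
  After the common initial part has been stripped, two different paths with the same ends branch at
  some \<open>x\<close>. Follow the first one up to its first vertex \<open>z\<close> on the second one and return along the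
  second one: this is a cycle. It has at least three vertices, because the paths leave \<open>x\<close> through
  different vertices, so that one of the two pieces between \<open>x\<close> and \<open>z\<close> is not empty.
\<close>

lemma undirected_forest_path_unique:
  assumes "undirected_forest F"
    and "vpath p (with_proj F)" "vpath q (with_proj F)" "hd p = hd q" "last p = last q"
  shows "p = q"
  using assms(2-)
proof (induction p arbitrary: q)
  case Nil
  then show ?case by (simp add: vpath_def vwalk_def)
next
  case (Cons x p)
  interpret F: pair_graph F using assms(1) by (simp add: undirected_forest_def)
  obtain q' where q: "q = x # q'" using Cons.prems(2,3) by (cases q) (auto simp: vpath_def vwalk_def)
  have walks: "vwalk (x # p) (with_proj F)" "vwalk (x # q') (with_proj F)"
    and dist: "distinct (x # p)" "distinct (x # q')" using Cons.prems(1,2) q by (auto simp: vpath_def)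
  show ?case
  proof (cases "p = [] \<or> q' = []")
    case True
    have "p = [] \<longleftrightarrow> q' = []"
      using Cons.prems(4) q dist last_in_set[of p] last_in_set[of q'] by (auto split: if_splits)
    then show ?thesis using True q by simp
  next
    case False
    then have last: "last p = last q'" using Cons.prems(4) q by simp
    have tails: "vpath p (with_proj F)" "vpath q' (with_proj F)"
      using walks dist False by (auto simp: vpath_def elim: vwalk_consE)
    show ?thesis
    proof (cases "hd p = hd q'")
      case True
      then show ?thesis using Cons.IH[OF tails] last q by simp
    next
      case neq: False
      have "last p \<in> set p" "last p \<in> set q'"
        using False last_in_set[of p] last_in_set[of q'] last by auto
      then have "\<exists>y\<in>set p. y \<in> set q'" by blast
      then obtain p1 z p2 where p: "p = p1 @ z # p2" "z \<in> set q'" "\<forall>y\<in>set p1. y \<notin> set q'"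
        by (rule split_list_first_propE)
      obtain q1 q2 where q': "q' = q1 @ z # q2" using p(2) by (meson split_list)
      let ?a = "x # p1 @ [z]" and ?b = "x # q1 @ [z]"
      have "vwalk (?a @ p2) (with_proj F)" "vwalk (?b @ q2) (with_proj F)"
        using walks p(1) q' by simp_all
      then have ab: "vwalk ?a (with_proj F)" "vwalk ?b (with_proj F)"
        using vwalkI_append_l[of ?a p2] vwalkI_append_l[of ?b q2] by auto
      have "vwalk (rev ?b) (with_proj F)"
        by (rule vwalk_rev[OF ab(2)]) (use F.arcs_symmetric in \<open>auto intro: symI\<close>)
      let ?c = "?a @ rev q1 @ [x]"
      have c: "vwalk ?c (with_proj F)"
        using \<open>vwalk (rev ?b) (with_proj F)\<close> ab(1) vwalk_arcs_append[of ?a "rev q1 @ [x]"]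
          vwalk_arcs_append[of "[z]" "rev q1 @ [x]"] by (auto simp: vwalk_def)
      have "pre_digraph.cycle (with_proj F) (vwalk_arcs ?c)"
        unfolding F.cycle_def F.awalk_def
      proof (intro exI conjI)
        show "x \<in> pverts F" using walks(1) by (auto simp: vwalk_def)
        show "set (vwalk_arcs ?c) \<subseteq> parcs F" using c by (simp add: vwalk_def)
        show "pcas x (vwalk_arcs ?c) x" using awalk_of_vwalk(1)[OF c] by simp
        show "distinct (tl (pawalk_verts x (vwalk_arcs ?c)))"
          using awalk_of_vwalk(2)[OF c] dist p q' by auto
        show "vwalk_arcs ?c \<noteq> []" by (simp add: vwalk_arcs_append)
      qed
      moreover have "length (vwalk_arcs ?c) \<ge> 3"
      proof -
        have "p1 \<noteq> [] \<or> q1 \<noteq> []" using neq p(1) q' by auto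
        then have "length p1 + length q1 \<ge> 1" by (cases p1; cases q1) auto
        then have "3 \<le> length ?c - 1" by simp
        then show ?thesis using vwalk_length_simp[of ?c] unfolding vwalk_length_def by (simp only:)
      qed
      ultimately show ?thesis using assms(1) by (auto simp: undirected_forest_def)
    qed
  qed
qed

text \<open>
  Any rooted forest gives a labelling: the label of a vertex is the path that leads to it from
  the root of its component.
\<close>

definition root_path :: "'a pair_pre_digraph \<Rightarrow> 'a set \<Rightarrow> 'a \<Rightarrow> 'a list" where
  "root_path F R v = (THE p. vpath p (with_proj F) \<and> hd p \<in> R \<and> last p = v)"

lemma rooted_forest_path_unique:
  assumes rf: "rooted_forest F R"
    and p: "vpath p (with_proj F)" "hd p \<in> R" and q: "vpath q (with_proj F)" "hd q \<in> R"
    and eq: "last p = last q"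
  shows "p = q"
proof -
  have uf: "undirected_forest F" using rf by (simp add: rooted_forest_def)
  then interpret F: pair_graph F by (simp add: undirected_forest_def)
  let ?v = "last p"
  have "?v \<in> pverts F" using p(1) by (auto simp: vpath_def vwalk_def)
  then have scc: "F.scc_of ?v \<in> F.sccs_verts" by (rule F.scc_of_in_sccs_verts)
  have "hd p \<rightarrow>\<^sup>*\<^bsub>with_proj F\<^esub> ?v" "hd q \<rightarrow>\<^sup>*\<^bsub>with_proj F\<^esub> ?v"
    using p q eq F.reachable_vpath_conv by metis+
  then have "hd p \<in> F.scc_of ?v" "hd q \<in> F.scc_of ?v"
    using F.symmetric_reachable' by (auto simp: F.scc_of_def)
  then have "hd p = hd q" using rf scc p(2) q(2) unfolding rooted_forest_def by blast
  then show ?thesis using undirected_forest_path_unique[OF uf p(1) q(1)] eq by blast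
qed

lemma root_path:
  assumes rf: "rooted_forest F R" and v: "v \<in> pverts F"
  shows "vpath (root_path F R v) (with_proj F)" "hd (root_path F R v) \<in> R" "last (root_path F R v) = v"
proof -
  interpret F: pair_graph F using rf by (simp add: rooted_forest_def undirected_forest_def)
  have "F.scc_of v \<in> F.sccs_verts" using v by (rule F.scc_of_in_sccs_verts)
  then obtain r where r: "r \<in> R" "r \<in> F.scc_of v" using rf unfolding rooted_forest_def by blast
  then have "r \<rightarrow>\<^sup>*\<^bsub>with_proj F\<^esub> v" by (simp add: F.scc_of_def)
  then obtain p where "vpath p (with_proj F)" "hd p = r" "last p = v"
    using F.reachable_vpath_conv by blast
  then have "\<exists>!p. vpath p (with_proj F) \<and> hd p \<in> R \<and> last p = v"
    using r(1) rooted_forest_path_unique[OF rf] by (intro ex1I[of _ p]) auto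
  then have "vpath (root_path F R v) (with_proj F) \<and> hd (root_path F R v) \<in> R \<and> last (root_path F R v) = v"
    unfolding root_path_def by (rule theI')
  then show "vpath (root_path F R v) (with_proj F)" "hd (root_path F R v) \<in> R" "last (root_path F R v) = v"
    by simp_all
qed

lemma root_path_eq:
  assumes "rooted_forest F R" "vpath p (with_proj F)" "hd p \<in> R"
  shows "root_path F R (last p) = p"
proof -
  have "last p \<in> pverts F" using assms(2) by (auto simp: vpath_def vwalk_def)
  from root_path[OF assms(1) this] show ?thesis using rooted_forest_path_unique[OF assms(1)] assms(2,3) by blast
qed

lemma root_path_prefix:
  assumes rf: "rooted_forest F R" and p: "vpath p (with_proj F)" "hd p \<in> R" and u: "u \<in> set p"
  shows "prefix (root_path F R u) p"
proof -
  obtain xs ys where split: "p = (xs @ [u]) @ ys" using u by (metis append.assoc append_Cons append_Nil split_list)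
  have "vpath (xs @ [u]) (with_proj F)"
    using p(1) vwalkI_append_l[of "xs @ [u]" ys] unfolding split by (auto simp: vpath_def)
  moreover have "hd (xs @ [u]) \<in> R" using p(2) split by (cases xs) auto
  ultimately have "root_path F R u = xs @ [u]" using root_path_eq[OF rf, of "xs @ [u]"] by simp
  then show ?thesis using split by (simp add: prefix_def)
qed

text \<open>
  The longest root path of a member of the chain \<open>S\<close> contains all of \<open>S\<close>. A longest root path with
  this property ends in a leaf.
\<close>

lemma root_path_chain_in_root_to_leaf_path:
  assumes rf: "rooted_forest F R" and S: "S \<subseteq> pverts F" "S \<noteq> {}" "label_chain (root_path F R) S"
  obtains p where "root_to_leaf_path F R p" "S \<subseteq> set p"
proof -
  interpret F: pair_graph F using rf by (simp add: rooted_forest_def undirected_forest_def)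
  let ?P = "root_path F R" and ?len = "\<lambda>v. length (root_path F R v)"
  have self: "v \<in> set (?P v)" if "v \<in> pverts F" for v
    using root_path(1,3)[OF rf that] last_in_set[of "?P v"] by (auto simp: vpath_def vwalk_def)
  have "finite S" using S(1) F.pair_finite_verts by (rule finite_subset)
  then have "Max (?len ` S) \<in> ?len ` S" using S(2) by (intro Max_in) auto
  then obtain m where m: "m \<in> S" "?len m = Max (?len ` S)" by auto
  have mmax: "?len v \<le> ?len m" if "v \<in> S" for v using that m(2) \<open>finite S\<close> by simp
  have "S \<subseteq> set (?P m)"
  proof
    fix v assume v: "v \<in> S"
    have "prefix (?P v) (?P m)"
      using S(3) v m(1) mmax[OF v] unfolding label_chain_def
      by (metis prefix_length_prefix prefix_order.order_refl)
    then show "v \<in> set (?P m)" using self v S(1) set_mono_prefix by blast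
  qed
  let ?W = "{w \<in> pverts F. S \<subseteq> set (?P w)}"
  have fin: "finite ?W" using F.pair_finite_verts by simp
  have "m \<in> ?W" using m(1) S(1) \<open>S \<subseteq> set (?P m)\<close> by blast
  then have "Max (?len ` ?W) \<in> ?len ` ?W" using fin by (intro Max_in) auto
  then obtain w where w: "w \<in> ?W" "?len w = Max (?len ` ?W)" by auto
  have wmax: "?len v \<le> ?len w" if "v \<in> ?W" for v using that w(2) fin by simp
  have P: "vpath (?P w) (with_proj F)" "hd (?P w) \<in> R" "last (?P w) = w"
    using root_path[OF rf] w(1) by simp_all
  have "\<not> descendant F R w x" for x
  proof
    assume "descendant F R w x"
    then obtain q where q: "x \<noteq> w" "vpath q (with_proj F)" "hd q \<in> R" "last q = x" "w \<in> set q"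
      by (auto simp: descendant_def)
    have x: "?P x = q" using root_path_eq[OF rf q(2,3)] q(4) by simp
    have "prefix (?P w) (?P x)" using root_path_prefix[OF rf q(2,3,5)] x by simp
    moreover have "x \<in> pverts F" using q(2,4) by (auto simp: vpath_def vwalk_def)
    ultimately have "x \<in> ?W" using w(1) set_mono_prefix by blast
    then have "?P w = ?P x" using \<open>prefix (?P w) (?P x)\<close> wmax[of x]
      by (metis linorder_not_less prefix_length_less strict_prefix_def)
    then show False using P(3) q(1,4) x by simp
  qed
  then have "root_to_leaf_path F R (?P w)" using P by (simp add: root_to_leaf_path_def)
  then show thesis using w(1) that by blast
qed

lemma labelling_of_elimination_forest:
  assumes "pair_graph G" and ef: "elimination_forest G F R" and depth: "alpha_depth G F R \<le> n"
  shows "elimination_labelling (parcs G) (pverts G) (alpha_at_most (parcs G) n) (root_path F R)"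
proof -
  interpret G: pair_graph G by fact
  have rf: "rooted_forest F R" and V: "pverts F = pverts G" using ef by (auto simp: elimination_forest_def)
  have sub: "set p \<subseteq> pverts G" if "root_to_leaf_path F R p" for p
    using that V by (auto simp: root_to_leaf_path_def vpath_def vwalk_def)
  show ?thesis
    unfolding elimination_labelling_def
  proof (intro conjI ballI allI impI)
    show "inj_on (root_path F R) (pverts G)"
      using root_path(3)[OF rf] V by (metis inj_onI)
  next
    fix u v assume "(u, v) \<in> parcs G"
    then obtain p where p: "root_to_leaf_path F R p" "u \<in> set p" "v \<in> set p"
      using ef by (auto simp: elimination_forest_def)
    then have "prefix (root_path F R u) p" "prefix (root_path F R v) p"
      using root_path_prefix[OF rf] by (auto simp: root_to_leaf_path_def)
    then show "comparable (root_path F R u) (root_path F R v)" using prefix_same_cases by blast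
  next
    fix S assume S: "S \<subseteq> pverts G" "label_chain (root_path F R) S"
    show "alpha_at_most (parcs G) n S"
    proof (cases "S = {}")
      case True
      then show ?thesis by (simp add: alpha_at_most_def)
    next
      case False
      then obtain p where p: "root_to_leaf_path F R p" "S \<subseteq> set p"
        using root_path_chain_in_root_to_leaf_path[OF rf _ _ S(2)] S(1) V by blast
      have "alpha_at_most (parcs G) n (set p)"
        using depth p(1) alpha_depth_le_iff[OF G.pair_finite_verts sub] by blast
      then show ?thesis using p(2) by (rule alpha_at_most_mono[OF _ order_refl])
    qed
  qed
qed

text \<open>
  The bridge between the two formulations. The least element in the definition of the
  \<open>\<alpha>\<close>-treedepth is attained because putting all vertices in a row is always possible.
\<close>

lemma alpha_treedepth_le_iff:
  assumes "pair_graph G"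
  shows "alpha_treedepth G \<le> n \<longleftrightarrow> eliminable (parcs G) (pverts G) (alpha_at_most (parcs G) n)"
proof -
  interpret G: pair_graph G by fact
  let ?attained = "\<lambda>m. \<exists>F R. elimination_forest G F R \<and> alpha_depth G F R = m"
  have le: "\<exists>i\<le>m. ?attained i"
    if "eliminable (parcs G) (pverts G) (alpha_at_most (parcs G) m)" for m
    using that elimination_forest_of_labelling[OF assms] unfolding eliminable_def by metis
  have "eliminable (parcs G) (pverts G) (alpha_at_most (parcs G) (card (pverts G)))"
  proof (rule eliminable_top[OF G.pair_finite_verts order_refl])
    have "alpha_at_most (parcs G) (card (pverts G)) T" if "T \<subseteq> pverts G" for T
      using that G.pair_finite_verts by (meson alpha_at_most_card card_mono finite_subset)
    then show "eliminable (parcs G) (pverts G - pverts G)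
        (\<lambda>S. \<forall>T\<subseteq>pverts G. alpha_at_most (parcs G) (card (pverts G)) (T \<union> S))"
      using eliminable_empty[of "\<lambda>S. \<forall>T\<subseteq>pverts G. alpha_at_most (parcs G) (card (pverts G)) (T \<union> S)"]
      by simp
  qed
  then have "\<exists>m. ?attained m" using le by blast
  then have "?attained (alpha_treedepth G)" unfolding alpha_treedepth_def by (rule LeastI_ex)
  then obtain F R where FR: "elimination_forest G F R" "alpha_depth G F R = alpha_treedepth G" by blast
  show ?thesis
  proof
    assume "alpha_treedepth G \<le> n"
    then show "eliminable (parcs G) (pverts G) (alpha_at_most (parcs G) n)"
      using labelling_of_elimination_forest[OF assms FR(1)] FR(2) unfolding eliminable_def by auto
  next
    assume "eliminable (parcs G) (pverts G) (alpha_at_most (parcs G) n)"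
    then obtain i where i: "i \<le> n" "?attained i" using le by blast
    have "alpha_treedepth G \<le> i" unfolding alpha_treedepth_def using i(2) by (rule Least_le)
    then show "alpha_treedepth G \<le> n" using i(1) by simp
  qed
qed

section \<open>Independence treedepth of paths\<close>

lemma pair_graph_path_graph: "pair_graph (path_graph k)"
proof
  show "finite (parcs (path_graph k))"
    by (rule finite_subset[of _ "{..<k} \<times> {..<k}"]) (auto simp: path_graph_def)
  show "symmetric (with_proj (path_graph k))"
    by (auto simp: symmetric_def sym_def path_graph_def)
qed (auto simp: path_graph_def)

theorem alpha_treedepth_path_graph_le_iff:
  "alpha_treedepth (path_graph k) \<le> n \<longleftrightarrow> k + 3 \<le> 3 * 2 ^ n"
proof -
  have V: "pverts (path_graph k) = {0..<k}" by (auto simp: path_graph_def)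
  show ?thesis
    unfolding alpha_treedepth_le_iff[OF pair_graph_path_graph] V
    using eliminable_interval[of k k 0 n] labelled_interval_length[of k k 0 n]
    by (auto simp: eliminable_def)
qed

corollary alpha_treedepth_path_graph:
  "int (alpha_treedepth (path_graph k)) = \<lceil>log 2 (real k / 3 + 1)\<rceil>"
proof -
  have iff: "alpha_treedepth (path_graph k) \<le> n \<longleftrightarrow> log 2 (real k / 3 + 1) \<le> real n" for n
  proof -
    have "k + 3 \<le> 3 * 2 ^ n \<longleftrightarrow> real (k + 3) \<le> real (3 * 2 ^ n)" by (simp only: of_nat_le_iff)
    also have "\<dots> \<longleftrightarrow> real k / 3 + 1 \<le> 2 powr real n" by (simp add: powr_realpow field_simps)
    also have "\<dots> \<longleftrightarrow> log 2 (real k / 3 + 1) \<le> real n" by (subst log_le_iff) auto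
    finally show ?thesis by (simp add: alpha_treedepth_path_graph_le_iff)
  qed
  have nonneg: "0 \<le> \<lceil>log 2 (real k / 3 + 1)\<rceil>"
  proof -
    have "0 \<le> log 2 (real k / 3 + 1)" by (subst zero_le_log_cancel_iff) auto
    also have "\<dots> \<le> \<lceil>log 2 (real k / 3 + 1)\<rceil>" by (rule le_of_int_ceiling)
    finally show ?thesis by simp
  qed
  show ?thesis
  proof (rule antisym)
    have "log 2 (real k / 3 + 1) \<le> real (nat \<lceil>log 2 (real k / 3 + 1)\<rceil>)"
      using nonneg le_of_int_ceiling[of "log 2 (real k / 3 + 1)"] by (simp add: of_nat_nat)
    then show "int (alpha_treedepth (path_graph k)) \<le> \<lceil>log 2 (real k / 3 + 1)\<rceil>"
      using iff nonneg by (metis nat_le_iff of_nat_le_iff int_nat_eq)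
    have "log 2 (real k / 3 + 1) \<le> real (alpha_treedepth (path_graph k))" using iff by blast
    then show "\<lceil>log 2 (real k / 3 + 1)\<rceil> \<le> int (alpha_treedepth (path_graph k))"
      by (simp add: ceiling_le_iff)
  qed
qed

section \<open>Graphs without a long induced path and a large induced star\<close>

lemma induced_path_imp_induced_path_graph:
  assumes "pair_graph G" and p: "induced_path (parcs G) (pverts G) p"
  shows "\<exists>H. induced_subgraph H (with_proj G) \<and> digraph_iso (with_proj (path_graph (length p))) H"
proof -
  interpret G: pair_graph G by fact
  interpret P: pair_graph "path_graph (length p)" by (rule pair_graph_path_graph)
  let ?k = "length p"
  let ?hom = "\<lparr>iso_verts = (!) p, iso_arcs = map_prod ((!) p) ((!) p), iso_head = snd, iso_tail = fst\<rparr>"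
  have dist: "distinct p" and sub: "set p \<subseteq> pverts G" using p by (auto simp: induced_path_def)
  have inj: "inj_on ((!) p) {..<?k}" using dist by (simp add: inj_on_nth)
  have hom: "pre_digraph.digraph_isomorphism (with_proj (path_graph ?k)) ?hom"
    unfolding P.digraph_isomorphism_def
  proof (intro conjI)
    show "inj_on (iso_verts ?hom) (pverts (path_graph ?k))" using inj by (simp add: path_graph_def)
    have "inj_on (map_prod ((!) p) ((!) p)) ({..<?k} \<times> {..<?k})" using inj by (rule map_prod_inj_on[OF _ inj])
    then show "inj_on (iso_arcs ?hom) (parcs (path_graph ?k))"
      by (simp) (rule inj_on_subset, auto simp: path_graph_def)
  qed (auto simp: P.wf_digraph)
  have "app_iso ?hom (with_proj (path_graph ?k)) = with_proj G \<restriction> set p"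
  proof -
    have "(!) p ` {..<?k} = set p" by (auto simp: set_conv_nth)
    moreover have "map_prod ((!) p) ((!) p) ` parcs (path_graph ?k) =
        {e \<in> parcs G. fst e \<in> set p \<and> snd e \<in> set p}"
    proof -
      have adj: "(p ! i, p ! j) \<in> parcs G \<longleftrightarrow> (i, j) \<in> parcs (path_graph ?k)"
        if "i < ?k" "j < ?k" for i j
        using p that by (auto simp: induced_path_def path_graph_def)
      have bound: "i < ?k \<and> j < ?k" if "(i, j) \<in> parcs (path_graph ?k)" for i j
        using that by (simp add: path_graph_def)
      show ?thesis
      proof (intro equalityI subsetI)
        fix e assume "e \<in> map_prod ((!) p) ((!) p) ` parcs (path_graph ?k)"
        then obtain i j where "(i, j) \<in> parcs (path_graph ?k)" "e = (p ! i, p ! j)" by auto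
        then show "e \<in> {e \<in> parcs G. fst e \<in> set p \<and> snd e \<in> set p}"
          using adj bound[of i j] by simp
      next
        fix e assume e: "e \<in> {e \<in> parcs G. fst e \<in> set p \<and> snd e \<in> set p}"
        then obtain i j where ij: "i < ?k" "j < ?k" "e = (p ! i, p ! j)"
          by (metis (mono_tags, lifting) in_set_conv_nth mem_Collect_eq prod.collapse)
        then have "(i, j) \<in> parcs (path_graph ?k)" using e adj by simp
        then show "e \<in> map_prod ((!) p) ((!) p) ` parcs (path_graph ?k)"
          using ij(3) by (metis map_prod_imageI)
      qed
    qed
    ultimately show ?thesis
      by (simp add: app_iso_def induce_subgraph_def path_graph_def with_proj_def)
  qed
  then have "digraph_iso (with_proj (path_graph ?k)) (with_proj G \<restriction> set p)"
    using hom unfolding digraph_iso_def by metis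
  then show ?thesis using G.induced_induce[of "set p"] sub by auto
qed

lemma independent_neighbours_imp_induced_star:
  assumes "pair_graph G" and S: "S \<subseteq> pverts G" "independent (parcs G) S"
    and v: "v \<in> pverts G" "\<And>x. x \<in> S \<Longrightarrow> (v, x) \<in> parcs G"
  shows "\<exists>H. induced_subgraph H (with_proj G) \<and> complete_bipartite_digraph 1 (card S) H"
proof -
  interpret G: pair_graph G by fact
  let ?H = "\<lparr>pverts = insert v S, parcs = {v} \<times> S \<union> S \<times> {v}\<rparr>"
  have "v \<notin> S" using v(2) G.no_loops'[of v v] by blast
  have "{e \<in> parcs G. fst e \<in> insert v S \<and> snd e \<in> insert v S} = {v} \<times> S \<union> S \<times> {v}"
  proof -
    have "(a, b) \<in> parcs G \<and> a \<in> insert v S \<and> b \<in> insert v S \<longleftrightarrow>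
        a = v \<and> b \<in> S \<or> a \<in> S \<and> b = v" for a b
      using v(2) S(2) G.arcs_symmetric[of v] G.no_loops'[of v v] unfolding independent_def by blast
    then show ?thesis by (intro set_eqI) (simp add: split_paired_all)
  qed
  then have "with_proj ?H = with_proj G \<restriction> insert v S"
    by (simp add: induce_subgraph_def with_proj_def)
  then have "induced_subgraph (with_proj ?H) (with_proj G)"
    using G.induced_induce[of "insert v S"] S(1) v(1) by simp
  moreover have "complete_bipartite_digraph 1 (card S) (with_proj ?H)"
    unfolding complete_bipartite_digraph_pair_def
  proof (intro conjI exI)
    show "pverts ?H = {v} \<union> S" by simp
  qed (use \<open>v \<notin> S\<close> finite_subset[OF S(1) G.pair_finite_verts] in auto)
  ultimately show ?thesis by blast
qed

text \<open>
  An independent subset of the closed neighbourhood either consists of neighbours, and with \<open>d\<close> of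
  them \<open>v\<close> would be the centre of an induced star, or it is \<open>{v}\<close>, which has at most \<open>d - 1\<close>
  elements because \<open>2 \<le> d\<close>.
\<close>

lemma closed_neighbourhood_alpha:
  assumes "pair_graph G" and d: "d \<ge> 2" and v: "v \<in> pverts G"
    and free: "\<nexists>H. induced_subgraph H (with_proj G) \<and> complete_bipartite_digraph 1 d H"
  shows "alpha_at_most (parcs G) (d - 1) {x \<in> pverts G. x = v \<or> (v, x) \<in> parcs G}"
  unfolding alpha_at_most_def
proof (intro allI impI)
  fix T assume T: "T \<subseteq> {x \<in> pverts G. x = v \<or> (v, x) \<in> parcs G}" "independent (parcs G) T"
  show "card T \<le> d - 1"
  proof (rule ccontr)
    assume "\<not> card T \<le> d - 1"
    then have "d \<le> card T" by simp
    then obtain S where S: "S \<subseteq> T" "card S = d" by (meson obtain_subset_with_card_n)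
    have "v \<notin> S"
    proof
      assume "v \<in> S"
      then have "S \<subseteq> {v}" using S(1) T unfolding independent_def by blast
      then show False using card_mono[of "{v}" S] S(2) d by simp
    qed
    then have "\<And>x. x \<in> S \<Longrightarrow> (v, x) \<in> parcs G" "S \<subseteq> pverts G" using S(1) T(1) by auto
    then show False
      using independent_neighbours_imp_induced_star[OF assms(1), of S v] free S T(2) v
        independent_subset by blast
  qed
qed

lemma eliminable_edgeless:
  assumes "finite V" and "\<And>u v. u \<in> V \<Longrightarrow> v \<in> V \<Longrightarrow> (u, v) \<notin> E"
  shows "eliminable E V (alpha_at_most E 1)"
proof (rule eliminableI[of "\<lambda>v. [v]"])
  fix S assume S: "S \<subseteq> V" "label_chain (\<lambda>v. [v]) S"
  then have "u = v" if "u \<in> S" "v \<in> S" for u v using that by (auto simp: label_chain_def)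
  then have "S = {} \<or> (\<exists>v. S = {v})" by blast
  then show "alpha_at_most E 1 S" by (auto intro!: alpha_at_most_card)
qed (use assms(2) in \<open>auto simp: inj_on_def\<close>)

text \<open>
  The path argument needs \<open>3 \<le> k\<close> and \<open>2 \<le> d\<close>. In all other cases the graph has no edge, and
  the trees of an elimination forest can be single vertices.
\<close>

theorem alpha_treedepth_path_star_free:
  assumes "pair_graph G" "path_star_free k d G" "k \<ge> 1" "d \<ge> 1"
  shows "int (alpha_treedepth G) \<le> max 1 ((int d - 1) * (int k - 2))"
proof -
  interpret G: pair_graph G by fact
  let ?E = "parcs G" and ?V = "pverts G"
  have no_path: "length p \<noteq> k" if "induced_path ?E ?V p" for p
    using induced_path_imp_induced_path_graph[OF assms(1) that] assms(2)
    unfolding path_star_free_def by blast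
  have no_star: "\<nexists>H. induced_subgraph H (with_proj G) \<and> complete_bipartite_digraph 1 d H"
    using assms(2) unfolding path_star_free_def by blast
  show ?thesis
  proof (cases "k \<ge> 3 \<and> d \<ge> 2")
    case True
    have "sym ?E" using G.arcs_symmetric by (auto intro: symI)
    moreover have "irrefl ?E" using G.no_loops' by (auto simp: irrefl_def)
    ultimately have "eliminable ?E ?V (alpha_at_most ?E ((d - 1) * (k - 2)))"
      using True no_path closed_neighbourhood_alpha[OF assms(1) _ _ no_star]
      by (intro eliminable_of_no_induced_path[OF G.pair_finite_verts]) auto
    then have "alpha_treedepth G \<le> (d - 1) * (k - 2)" using alpha_treedepth_le_iff[OF assms(1)] by blast
    then have "int (alpha_treedepth G) \<le> int ((d - 1) * (k - 2))" by (simp only: of_nat_le_iff)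
    also have "\<dots> = (int d - 1) * (int k - 2)" using True by (simp add: of_nat_diff)
    finally show ?thesis by simp
  next
    case False
    have "(u, v) \<notin> ?E" if "u \<in> ?V" "v \<in> ?V" for u v
    proof
      assume e: "(u, v) \<in> ?E"
      have loop: "(x, x) \<notin> ?E" for x using G.no_loops' by blast
      then have "u \<noteq> v" using e by blast
      have path1: "induced_path ?E ?V [u]" using that(1) loop by (simp add: induced_path_single)
      have "induced_path ?E ?V (([] @ [u]) @ [v])"
        by (rule induced_path_snoc) (use e that loop path1 \<open>u \<noteq> v\<close> G.arcs_symmetric in \<open>auto intro: symI\<close>)
      then have "k \<noteq> 1" "k \<noteq> 2" using no_path path1 by fastforce+
      then have "d = 1" using False assms(3,4) by linarith
      moreover have "independent ?E {v}" using loop by (simp add: independent_def)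
      ultimately show False
        using independent_neighbours_imp_induced_star[OF assms(1), of "{v}" u] e that no_star by simp
    qed
    then have "alpha_treedepth G \<le> 1"
      using alpha_treedepth_le_iff[OF assms(1)] eliminable_edgeless[OF G.pair_finite_verts] by blast
    then show ?thesis by simp
  qed
qed

theorem theorem1p2:
  fixes k d :: nat
  assumes "k \<ge> 1" and "d \<ge> 1"
  shows "(int (alpha_treedepth (path_graph k)) = \<lceil>log 2 (real k / 3 + 1)\<rceil> \<and>
      real_of_int \<lceil>log 2 (real k / 3 + 1)\<rceil> \<ge> log 2 (real k / 3)) \<and>
    (\<forall>G :: 'a pair_pre_digraph. pair_graph G \<and> path_star_free k d G \<longrightarrow>
      int (alpha_treedepth G) \<le> max 1 ((int d - 1) * (int k - 2)))"
proof (intro conjI allI impI)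
  show "int (alpha_treedepth (path_graph k)) = \<lceil>log 2 (real k / 3 + 1)\<rceil>"
    by (rule alpha_treedepth_path_graph)
  have "log 2 (real k / 3) \<le> log 2 (real k / 3 + 1)" using assms(1) by simp
  then show "log 2 (real k / 3) \<le> real_of_int \<lceil>log 2 (real k / 3 + 1)\<rceil>"
    using le_of_int_ceiling order_trans by blast
  fix G :: "'a pair_pre_digraph"
  assume "pair_graph G \<and> path_star_free k d G"
  then show "int (alpha_treedepth G) \<le> max 1 ((int d - 1) * (int k - 2))"
    using alpha_treedepth_path_star_free assms by blast
qed

end
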